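(* In the least squares SDP setting of the context, assume that $\mathcal{A}:\mathbb{S}^n\to\mathbb{Y}$ is surjective and that there exists $\widehat{X}\in\mathbb{S}^n$ with $\mathcal{A}\widehat{X}=b$ and $\widehat{X}\succ 0$. Let $$\bar\mu=\sigma_{\min}^{-1}(\mathcal{A})\max\{\lambda_{\min}^{-1}(\widehat{X}),\ 1+\lambda_{\min}^{-1}(\widehat{X})\|\widehat{X}\|\}$$ and let $\bar\nu$ be any positive constant. Suppose that for some $k\ge 0$, $\varepsilon_k>0$, $\eta_k>0$ and $X^k\in\mathbb{S}^n_+$ is not an optimal solution to problem (P). Let $\{z^{k,j}\}_{j\ge 0}$, $z^{k,j}=(y^{k,j},w^{k,j},S^{k,j})$, be any sequence such that $\zeta_k(z^{k,j})\to\inf\zeta_k$ with $(y^{k,j},w^{k,j})\in\mathbb{Y}\times\mathbb{W}$ and $S^{k,j}=\mathcal{S}_k(y^{k,j},w^{k,j})$. For any $j\ge 0$, let $$X^{k,j}:=\Pi_{\mathbb{S}^n_+}(X^k+c_k(\mathcal{A}^*y^{k,j}+\mathcal{F}^*w^{k,j}-C)),\qquad u^{k,j}:=\mathcal{A}X^{k,j}-b,$$ $$t_j:=\bar\nu^{-1}\min\left\{\frac{\varepsilon_k^2}{2c_k},\ \frac{\eta_k^2}{2c_k}\|X^{k,j}-X^k\|^2\right\}.$$ Then there exists $\bar j\ge 0$ such that for any $j\ge\bar j$, $$\zeta_k(z^{k,j})-f_k(X^{k,j})\le t_j,\qquad (1+\|X^{k,j}\|)\|u^{k,j}\|\le\min\left\{1,\sqrt{c_k},\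 \sqrt{t_j}/\|\nabla f_k(X^{k,j})\|\right\}\sqrt{t_j}.$$ Consequently, for all $j\ge\bar j$, $$\zeta_k(z^{k,j})-\inf\zeta_k\le\left(1+\bar\mu+\tfrac12\lambda_{\max}(\mathcal{F}^*\mathcal{F})\bar\mu^2+\tfrac12\bar\mu^2\right)t_j.$$
   Context: $\mathbb{S}^n$: real symmetric $n\times n$ matrices with trace inner product and Frobenius norm $\|\cdot\|$; $\mathbb{S}^n_+$: positive semidefinite cone; $X\succ0$ means positive definite; $\lambda_{\min},\lambda_{\max}$ are smallest/largest eigenvalues; $\Pi_{\mathbb{S}^n_+}$ is the metric projection. $\mathbb{Y},\mathbb{W}$ are finite dimensional real Euclidean spaces; $\mathcal{F}:\mathbb{S}^n\to\mathbb{W}$, $\mathcal{A}:\mathbb{S}^n\to\mathbb{Y}$ are linear with adjoints $\mathcal{F}^*,\mathcal{A}^*$; $\sigma_{\min}(\mathcal{A})$ is the smallest positive singular value of $\mathcal{A}$; $C\in\mathbb{S}^n$, $b\in\mathbb{Y}$, $d\in\mathbb{W}$; $h(w)=\frac12\|w-d\|^2$ on $\mathbb{W}$, with conjugate $h^*$. Problem (P): $\max\{-h(\mathcal{F}X)-\langle C,X\rangle:\ \mathcal{A}X=b,\ X\in\mathbb{S}^n_+\}$. Its dual: $\min\{-\langle b,y\rangle+h^*(-w):\mathcal{A}^*y+\mathcal{F}^*w+S=C,\ z=(y,w,S)\in\mathbb{D}\}$, $\mathbb{D}=\mathbb{Y}\times\mathbb{W}\times\mathbb{S}^n_+$. $c_k>0$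 is a given penalty parameter. For $z=(y,w,S)\in\mathbb{D}$, $$\zeta_k(z)=-\langle b,y\rangle+h^*(-w)+\langle X^k,\mathcal{A}^*y+\mathcal{F}^*w+S-C\rangle+\frac{c_k}{2}\|\mathcal{A}^*y+\mathcal{F}^*w+S-C\|^2$$ is the augmented Lagrangian function at $X^k$, $\inf\zeta_k$ is its infimum over $\mathbb{D}$, $\mathcal{S}_k(y,w)=\Pi_{\mathbb{S}^n_+}(C-\mathcal{A}^*y-\mathcal{F}^*w-c_k^{-1}X^k)$, and $f_k(X)=-h(\mathcal{F}X)-\langle C,X\rangle-\|X-X^k\|^2/(2c_k)$ for $X\in\mathbb{S}^n$. The quantity $\sqrt{t_j}/\|\nabla f_k(X^{k,j})\|$ is read as $+\infty$ when $\nabla f_k(X^{k,j})=0$. *)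

theory Defs
  imports "HOL-Analysis.Analysis"
begin

section \<open>The Euclidean space of real symmetric matrices\<close>

text \<open>
  Symmetric matrices form a type of class \<open>euclidean_space\<close>, so that linear maps on them, their
  adjoints and the metric projection are the library's own \<open>linear\<close>, \<open>adjoint\<close> and
  \<open>closest_point\<close>.  Working with all square matrices instead would give the wrong adjoints,
  whose values need not be symmetric.
\<close>

typedef ('n::finite) symmat = "{M :: real^'n^'n. transpose M = M}"
  morphisms mat_of Symmat
proof
  show "0 \<in> {M :: real^'n^'n. transpose M = M}"
    by (simp add: transpose_def vec_eq_iff)
qed

lemma transpose_mat_of [simp]: "transpose (mat_of X) = mat_of X"
  using mat_of[of X] by simp

lemma mat_of_sym: "mat_of X $ i $ j = mat_of X $ j $ i"
  using arg_cong[OF transpose_mat_of[of X], of "\<lambda>M. M $ j $ i"] by (simp add: transpose_def)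

lemma symmat_eq_iff: "X = Y \<longleftrightarrow> mat_of X = mat_of Y"
  by (simp add: mat_of_inject)

lemma mat_of_Symmat: "transpose M = M \<Longrightarrow> mat_of (Symmat M) = M"
  by (simp add: Symmat_inverse)

instantiation symmat :: (finite) real_inner
begin

definition "0 = Symmat 0"
definition "X + Y = Symmat (mat_of X + mat_of Y)"
definition "- X = Symmat (- mat_of X)"
definition "X - Y = Symmat (mat_of X - mat_of Y)"
definition "scaleR r X = Symmat (r *\<^sub>R mat_of X)"
definition "inner X Y = trace (mat_of X ** mat_of Y)"
definition "norm X = sqrt (inner X X)" for X :: "'a symmat"
definition "sgn X = inverse (norm X) *\<^sub>R X" for X :: "'a symmat"
definition "dist X Y = norm (X - Y)" for X Y :: "'a symmat"
definition "(uniformity :: ('a symmat \<times> 'a symmat) filter)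
  = (INF e\<in>{0 <..}. principal {(X, Y). dist X Y < e})"
definition "open U \<longleftrightarrow> (\<forall>X\<in>U. \<forall>\<^sub>F (X', Y) in uniformity. X' = X \<longrightarrow> Y \<in> U)"
  for U :: "'a symmat set"

lemma mat_of_zero: "mat_of (0 :: 'a symmat) = 0"
  unfolding zero_symmat_def by (rule mat_of_Symmat) (simp add: transpose_def vec_eq_iff)

lemma mat_of_add: "mat_of (X + Y) = mat_of X + mat_of (Y :: 'a symmat)"
  unfolding plus_symmat_def
  by (rule mat_of_Symmat) (simp add: transpose_def vec_eq_iff mat_of_sym)

lemma mat_of_uminus: "mat_of (- X) = - mat_of (X :: 'a symmat)"
  unfolding uminus_symmat_def
  by (rule mat_of_Symmat) (simp add: transpose_def vec_eq_iff mat_of_sym)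

lemma mat_of_diff: "mat_of (X - Y) = mat_of X - mat_of (Y :: 'a symmat)"
  unfolding minus_symmat_def
  by (rule mat_of_Symmat) (simp add: transpose_def vec_eq_iff mat_of_sym)

lemma mat_of_scaleR: "mat_of (r *\<^sub>R X) = r *\<^sub>R mat_of (X :: 'a symmat)"
  unfolding scaleR_symmat_def
  by (rule mat_of_Symmat) (simp add: transpose_def vec_eq_iff mat_of_sym)

lemma inner_symmat_eq: "inner X Y = inner (mat_of X) (mat_of (Y :: 'a symmat))"
  unfolding inner_symmat_def
  by (simp add: trace_def matrix_matrix_mult_def inner_vec_def mat_of_sym[of Y])

instance
proof
  fix X Y Z :: "'a symmat" and r s :: real
  show "X + Y + Z = X + (Y + Z)" "X + Y = Y + X" "0 + X = X" "- X + X = 0" "X - Y = X + - Y"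
    by (simp_all add: symmat_eq_iff mat_of_add mat_of_zero mat_of_uminus mat_of_diff)
  show "r *\<^sub>R (X + Y) = r *\<^sub>R X + r *\<^sub>R Y" "(r + s) *\<^sub>R X = r *\<^sub>R X + s *\<^sub>R X"
    "r *\<^sub>R s *\<^sub>R X = (r * s) *\<^sub>R X" "1 *\<^sub>R X = X"
    by (simp_all add: symmat_eq_iff mat_of_add mat_of_scaleR algebra_simps)
  show "inner X Y = inner Y X"
    by (simp add: inner_symmat_eq inner_commute)
  show "inner (X + Y) Z = inner X Z + inner Y Z"
    "inner (r *\<^sub>R X) Y = r * inner X Y" "0 \<le> inner X X" "(inner X X = 0) = (X = 0)"
    by (simp_all add: inner_symmat_eq mat_of_add mat_of_scaleR inner_add_left
        mat_of_zero symmat_eq_iff)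
  show "sgn X = inverse (norm X) *\<^sub>R X" by (rule sgn_symmat_def)
  show "dist X Y = norm (X - Y)" by (rule dist_symmat_def)
  show "uniformity = (INF e\<in>{0<..}. principal {(X, Y :: 'a symmat). dist X Y < e})"
    by (rule uniformity_symmat_def)
  show "open U = (\<forall>X\<in>U. \<forall>\<^sub>F (X', Y) in uniformity. X' = X \<longrightarrow> Y \<in> U)" for U :: "'a symmat set"
    by (rule open_symmat_def)
  show "norm X = sqrt (inner X X)" by (rule norm_symmat_def)
qed

end

lemma ex_orthonormal_basis_symmat:
  "\<exists>B :: 'n::finite symmat set. B \<noteq> {} \<and> finite B \<and>
     (\<forall>U\<in>B. \<forall>V\<in>B. inner U V = (if U = V then 1 else 0)) \<and>
     (\<forall>X. (\<forall>U\<in>B. inner X U = 0) \<longleftrightarrow> X = 0)"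
proof -
  let ?S = "{M :: real^'n^'n. transpose M = M}"
  have sub: "subspace ?S"
    by (rule subspaceI) (auto simp: transpose_def vec_eq_iff)
  obtain B where B: "B \<subseteq> ?S" "pairwise orthogonal B" "\<And>x. x \<in> B \<Longrightarrow> norm x = 1"
    "independent B" "span B = ?S"
    by (metis orthonormal_basis_subspace[OF sub])
  have fin: "finite B" using B(4) by (rule independent_imp_finite)
  have mS: "mat_of (Symmat M) = M" if "M \<in> B" for M
    using that B(1) by (auto intro!: mat_of_Symmat)
  let ?B = "Symmat ` B"
  have "(mat 1 :: real^'n^'n) \<in> ?S" "(mat 1 :: real^'n^'n) \<noteq> 0"
    by (auto simp: mat_def vec_eq_iff transpose_def)
  then have "B \<noteq> {}" using B(5) by (metis singletonD span_empty)
  moreover have "inner U V = (if U = V then 1 else 0)" if UV: "U \<in> ?B" "V \<in> ?B" for U V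
  proof -
    obtain M N where MN: "M \<in> B" "N \<in> B" "U = Symmat M" "V = Symmat N" using UV by auto
    have "U = V \<longleftrightarrow> M = N" using MN mS by (auto simp: symmat_eq_iff)
    moreover have "inner U V = inner M N" using MN mS by (simp add: inner_symmat_eq)
    moreover have "inner M N = (if M = N then 1 else 0)"
      using B(2) B(3)[OF MN(1)] MN(1,2)
      by (auto simp: pairwise_def orthogonal_def norm_eq_1)
    ultimately show ?thesis by simp
  qed
  moreover have "(\<forall>U\<in>?B. inner X U = 0) \<longleftrightarrow> X = 0" for X :: "'n symmat"
  proof
    assume a: "\<forall>U\<in>?B. inner X U = 0"
    have o: "orthogonal (mat_of X) M" if "M \<in> B" for M
      using a that mS[OF that] by (auto simp: inner_symmat_eq orthogonal_def)
    have "mat_of X \<in> span B" using B(5) by simp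
    then have "orthogonal (mat_of X) (mat_of X)"
      using o orthogonal_to_span by blast
    then show "X = 0" by (simp add: symmat_eq_iff mat_of_zero orthogonal_self)
  qed simp
  ultimately show ?thesis using fin by (intro exI[of _ ?B]) blast
qed

instantiation symmat :: (finite) euclidean_space
begin

definition Basis_symmat :: "'a symmat set" where
  "Basis_symmat = (SOME B. B \<noteq> {} \<and> finite B \<and>
     (\<forall>U\<in>B. \<forall>V\<in>B. inner U V = (if U = V then 1 else 0)) \<and>
     (\<forall>X. (\<forall>U\<in>B. inner X U = 0) \<longleftrightarrow> X = 0))"

instance
  using someI_ex[OF ex_orthonormal_basis_symmat[where 'n='a], folded Basis_symmat_def]
  by intro_classes blast+

end


section \<open>Semidefiniteness, eigenvalues, singular values\<close>

definition psd_cone :: "'n::finite symmat set" where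
  "psd_cone = {X. \<forall>v. 0 \<le> v \<bullet> (mat_of X *v v)}"

definition pos_def :: "'n::finite symmat \<Rightarrow> bool" where
  "pos_def X \<longleftrightarrow> (\<forall>v. v \<noteq> 0 \<longrightarrow> 0 < v \<bullet> (mat_of X *v v))"

definition eigenvalues :: "('a::real_vector \<Rightarrow> 'a) \<Rightarrow> real set" where
  "eigenvalues T = {l. \<exists>v. v \<noteq> 0 \<and> T v = l *\<^sub>R v}"

text \<open>
  Only applied to self-adjoint operators on Euclidean spaces, whose sets of eigenvalues are finite
  and nonempty.
\<close>

definition min_eigenvalue :: "('a::real_vector \<Rightarrow> 'a) \<Rightarrow> real" where
  "min_eigenvalue T = Min (eigenvalues T)"

definition max_eigenvalue :: "('a::real_vector \<Rightarrow> 'a) \<Rightarrow> real" where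
  "max_eigenvalue T = Max (eigenvalues T)"

definition lambda_min :: "'n::finite symmat \<Rightarrow> real" where
  "lambda_min X = min_eigenvalue (\<lambda>v. mat_of X *v v)"

definition singular_values :: "('a::real_inner \<Rightarrow> 'b::real_inner) \<Rightarrow> real set" where
  "singular_values T = sqrt ` eigenvalues (adjoint T \<circ> T)"

definition sigma_min :: "('a::real_inner \<Rightarrow> 'b::real_inner) \<Rightarrow> real" where
  "sigma_min T = Min {s \<in> singular_values T. 0 < s}"


section \<open>Conjugates and gradients\<close>

text \<open>
  A real supremum: meaningful for functions, such as \<open>least_sq d\<close> below, whose conjugate is finite
  everywhere.
\<close>

definition conjugate :: "('w::real_inner \<Rightarrow> real) \<Rightarrow> 'w \<Rightarrow> real" where
  "conjugate f v = (SUP w. v \<bullet> w - f w)"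

definition least_sq :: "'w::real_inner \<Rightarrow> 'w \<Rightarrow> real" where
  "least_sq d w = 1/2 * (norm (w - d))\<^sup>2"

lemma bdd_above_conjugate_least_sq: "bdd_above (range (\<lambda>w. v \<bullet> w - least_sq d w))"
proof (rule bdd_aboveI2)
  fix w
  have "0 \<le> (norm (w - d - v))\<^sup>2" by simp
  then show "v \<bullet> w - least_sq d w \<le> v \<bullet> d + 1/2 * (norm v)\<^sup>2"
    unfolding least_sq_def power2_norm_eq_inner by (simp add: inner_simps inner_commute field_simps)
qed

definition gradient :: "('a::real_inner \<Rightarrow> real) \<Rightarrow> 'a \<Rightarrow> 'a" where
  "gradient f x = (THE g. GDERIV f x :> g)"


section \<open>The problem and its augmented Lagrangian\<close>

definition primal_objective ::
  "('w::real_inner \<Rightarrow> real) \<Rightarrow> ('n::finite symmat \<Rightarrow> 'w) \<Rightarrow> 'n symmat \<Rightarrow> 'n symmat \<Rightarrow> real" where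
  "primal_objective h F C X = - h (F X) - C \<bullet> X"

definition primal_feasible :: "('n::finite symmat \<Rightarrow> 'y) \<Rightarrow> 'y \<Rightarrow> 'n symmat set" where
  "primal_feasible A b = {X \<in> psd_cone. A X = b}"

definition primal_optimal ::
  "('w::real_inner \<Rightarrow> real) \<Rightarrow> ('n::finite symmat \<Rightarrow> 'w) \<Rightarrow> 'n symmat \<Rightarrow>
   ('n symmat \<Rightarrow> 'y) \<Rightarrow> 'y \<Rightarrow> 'n symmat \<Rightarrow> bool" where
  "primal_optimal h F C A b X \<longleftrightarrow>
     X \<in> primal_feasible A b \<and>
     (\<forall>X'\<in>primal_feasible A b. primal_objective h F C X' \<le> primal_objective h F C X)"

definition dual_domain :: "('y \<times> 'w \<times> 'n::finite symmat) set" where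
  "dual_domain = UNIV \<times> UNIV \<times> psd_cone"

definition aug_lagrangian ::
  "('w::real_inner \<Rightarrow> real) \<Rightarrow> ('n::finite symmat \<Rightarrow> 'w) \<Rightarrow> 'n symmat \<Rightarrow>
   ('n symmat \<Rightarrow> 'y::real_inner) \<Rightarrow> 'y \<Rightarrow> real \<Rightarrow> 'n symmat \<Rightarrow> 'y \<times> 'w \<times> 'n symmat \<Rightarrow> real" where
  "aug_lagrangian h F C A b c Xk = (\<lambda>(y, w, S).
     - (b \<bullet> y) + conjugate h (- w)
     + Xk \<bullet> (adjoint A y + adjoint F w + S - C)
     + c / 2 * (norm (adjoint A y + adjoint F w + S - C))\<^sup>2)"

text \<open>
  A real infimum: by weak duality \<open>aug_lagrangian\<close> is bounded below on \<open>dual_domain\<close> as soon as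
  \<open>primal_feasible A b\<close> is nonempty.
\<close>

definition inf_aug_lagrangian ::
  "('w::real_inner \<Rightarrow> real) \<Rightarrow> ('n::finite symmat \<Rightarrow> 'w) \<Rightarrow> 'n symmat \<Rightarrow>
   ('n symmat \<Rightarrow> 'y::real_inner) \<Rightarrow> 'y \<Rightarrow> real \<Rightarrow> 'n symmat \<Rightarrow> real" where
  "inf_aug_lagrangian h F C A b c Xk = (INF z\<in>dual_domain. aug_lagrangian h F C A b c Xk z)"

definition dual_slack ::
  "('n::finite symmat \<Rightarrow> 'w::real_inner) \<Rightarrow> 'n symmat \<Rightarrow> ('n symmat \<Rightarrow> 'y::real_inner) \<Rightarrow>
   real \<Rightarrow> 'n symmat \<Rightarrow> 'y \<Rightarrow> 'w \<Rightarrow> 'n symmat" where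
  "dual_slack F C A c Xk y w =
     closest_point psd_cone (C - adjoint A y - adjoint F w - inverse c *\<^sub>R Xk)"

definition prox_objective ::
  "('w::real_inner \<Rightarrow> real) \<Rightarrow> ('n::finite symmat \<Rightarrow> 'w) \<Rightarrow> 'n symmat \<Rightarrow>
   real \<Rightarrow> 'n symmat \<Rightarrow> 'n symmat \<Rightarrow> real" where
  "prox_objective h F C c Xk X = - h (F X) - C \<bullet> X - (norm (X - Xk))\<^sup>2 / (2 * c)"

text \<open>The ratio \<open>s / norm g\<close> counts as infinite, and so drops out of the minimum, when \<open>g = 0\<close>.\<close>

definition feasibility_factor :: "real \<Rightarrow> real \<Rightarrow> 'a::real_normed_vector \<Rightarrow> real" where
  "feasibility_factor c s g =
     (if g = 0 then min 1 (sqrt c) else Min {1, sqrt c, s / norm g})"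

end

theory Submission
  imports Defs
begin

text \<open>
  For every \<open>X\<close>, with \<open>N = A\<^sup>* y + F\<^sup>* w + S - C\<close>,
  the duality gap \<open>\<zeta> (y, w, S) - f X\<close> equals
  \<open>\<langle>A X - b, y\<rangle> + \<parallel>w + F X - d\<parallel>\<^sup>2 / 2 + \<langle>X, S\<rangle> + \<parallel>Xk + c N - X\<parallel>\<^sup>2 / (2 c)\<close>.
  The last two terms vanish at \<open>X j\<close> by the Moreau decomposition.  A gradient step shows that
  \<open>A X - b\<close> and \<open>w + F X - d\<close>, the partial gradients of \<open>\<zeta>\<close>, tend to zero along a minimizing sequence.
  The identity at perturbations of the Slater point \<open>Xhat\<close> bounds \<open>y j\<close> and \<open>X j\<close>, so the gap tends
  to zero.  Since \<open>Xk\<close> is not optimal, \<open>X j\<close> stays away from it and \<open>t j\<close> is bounded below, which gives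
  the first two estimates; no attainment of the dual infimum is needed.  For the last one, \<open>X j\<close> is
  corrected to feasibility by a least-norm solution of \<open>A D = b - A (X j)\<close> mixed with \<open>Xhat\<close>.
\<close>

subsection \<open>Adjoints and self-adjoint operators\<close>

text \<open>\<open>adjoint\<close> is a choice, meaningful only once some adjoint exists; expanding
  \<open>x\<close> over \<open>Basis\<close> supplies one.\<close>

lemma adjoint_eq:
  fixes T :: "'a::euclidean_space \<Rightarrow> 'b::real_inner"
  assumes "linear T"
  shows "T x \<bullet> w = x \<bullet> adjoint T w"
proof -
  have "T x \<bullet> w = x \<bullet> (\<Sum>i\<in>Basis. (T i \<bullet> w) *\<^sub>R i)" for x w
  proof -
    have "T x \<bullet> w = (\<Sum>i\<in>Basis. (x \<bullet> i) *\<^sub>R T i) \<bullet> w"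
      by (metis (mono_tags, lifting) assms euclidean_representation linear_scale linear_sum sum.cong)
    then show ?thesis
      by (simp add: inner_sum_left inner_sum_right mult.commute)
  qed
  then have "\<exists>T'. \<forall>x w. T x \<bullet> w = x \<bullet> T' w"
    by (intro exI[of _ "\<lambda>w. \<Sum>i\<in>Basis. (T i \<bullet> w) *\<^sub>R i"]) blast
  from someI_ex[OF this] show ?thesis
    unfolding adjoint_def by blast
qed

lemma linear_adjoint:
  fixes T :: "'a::euclidean_space \<Rightarrow> 'b::real_inner"
  assumes "linear T"
  shows "linear (adjoint T)"
proof (rule linearI)
  fix v w r
  show "adjoint T (v + w) = adjoint T v + adjoint T w"
    by (rule vector_eq_ldot[THEN iffD1])
      (simp add: inner_add_right flip: adjoint_eq[OF assms])
  show "adjoint T (r *\<^sub>R v) = r *\<^sub>R adjoint T v"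
    by (rule vector_eq_ldot[THEN iffD1]) (simp flip: adjoint_eq[OF assms])
qed

text \<open>A bound for \<open>T\<close> carries over: the square of
  \<open>norm (adjoint T w)\<close> is \<open>T (adjoint T w) \<bullet> w\<close>, and one factor
  cancels.\<close>

lemma adjoint_bounded:
  fixes T :: "'a::euclidean_space \<Rightarrow> 'b::real_inner"
  assumes "linear T"
  obtains K where "K \<ge> 0" "\<And>w. norm (adjoint T w) \<le> K * norm w"
proof -
  have "bounded_linear T" using assms by (simp add: linear_conv_bounded_linear)
  then obtain K where K: "K \<ge> 0" "\<And>x. norm (T x) \<le> norm x * K"
    using bounded_linear.nonneg_bounded by blast
  have "norm (adjoint T w) \<le> K * norm w" for w
  proof (cases "adjoint T w = 0")
    case False
    have "(norm (adjoint T w))\<^sup>2 = T (adjoint T w) \<bullet> w"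
      by (simp add: adjoint_eq[OF assms] power2_norm_eq_inner)
    also have "\<dots> \<le> norm (T (adjoint T w)) * norm w" by (rule norm_cauchy_schwarz)
    also have "\<dots> \<le> (norm (adjoint T w) * K) * norm w"
      by (intro mult_right_mono K) simp
    finally have "norm (adjoint T w) * norm (adjoint T w) \<le> norm (adjoint T w) * (K * norm w)"
      by (simp add: power2_eq_square mult_ac)
    with False show ?thesis by simp
  qed (use K(1) in simp)
  with K(1) show thesis by (rule that)
qed

lemma bounded_linear_adjoint:
  fixes T :: "'a::euclidean_space \<Rightarrow> 'b::real_inner"
  assumes "linear T"
  shows "bounded_linear (adjoint T)"
proof -
  obtain K where "\<And>w. norm (adjoint T w) \<le> K * norm w"
    using adjoint_bounded[OF assms] by blast
  then show ?thesis
    using linear_adjoint[OF assms]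
    by (auto simp: bounded_linear_def bounded_linear_axioms_def mult.commute)
qed

section \<open>Spectral bounds for self-adjoint operators\<close>

definition self_adjoint :: "('a::real_inner \<Rightarrow> 'a) \<Rightarrow> bool" where
  "self_adjoint T \<longleftrightarrow> linear T \<and> (\<forall>x y. T x \<bullet> y = x \<bullet> T y)"

lemma self_adjoint_gram:
  fixes T :: "'a::euclidean_space \<Rightarrow> 'b::real_inner"
  assumes "linear T"
  shows "self_adjoint (adjoint T \<circ> T)"
  unfolding self_adjoint_def
proof (intro conjI allI)
  show "linear (adjoint T \<circ> T)"
    by (rule linear_compose[OF assms linear_adjoint[OF assms]])
  fix x y
  have "(adjoint T \<circ> T) x \<bullet> y = T x \<bullet> T y"
    using adjoint_eq[OF assms, of y "T x"] by (simp add: inner_commute)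
  then show "(adjoint T \<circ> T) x \<bullet> y = x \<bullet> (adjoint T \<circ> T) y"
    by (simp add: adjoint_eq[OF assms])
qed

text \<open>The form at \<open>x - s *\<^sub>R y\<close> is a nonnegative quadratic in
  \<open>s\<close>, which is evaluated at its minimizer, or far out if it is affine.\<close>

lemma psd_form_cauchy_schwarz:
  fixes P :: "'a::real_inner \<Rightarrow> 'a"
  assumes "self_adjoint P" and nonneg: "\<And>x. 0 \<le> x \<bullet> P x"
  shows "(x \<bullet> P y)\<^sup>2 \<le> (x \<bullet> P x) * (y \<bullet> P y)"
proof -
  have lin: "linear P" and sym: "x \<bullet> P y = y \<bullet> P x" for x y
    using assms(1) by (auto simp: self_adjoint_def inner_commute)
  have q: "0 \<le> x \<bullet> P x - 2 * s * (x \<bullet> P y) + s\<^sup>2 * (y \<bullet> P y)" for s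
    using nonneg[of "x - s *\<^sub>R y"] sym[of y x]
    by (simp add: linear_diff[OF lin] linear_scale[OF lin] inner_simps power2_eq_square
        algebra_simps)
  show ?thesis
  proof (cases "y \<bullet> P y = 0")
    case True
    have "x \<bullet> P y = 0"
    proof (rule ccontr)
      assume "x \<bullet> P y \<noteq> 0"
      \<comment> \<open>The expression is affine in \<open>s\<close> here, and this \<open>s\<close>
        makes it equal to -1.\<close>
      with q[of "(x \<bullet> P x + 1) / (2 * (x \<bullet> P y))"] True show False by simp
    qed
    then show ?thesis using True by simp
  next
    case False
    then have "0 < y \<bullet> P y" using nonneg[of y] by simp
    then show ?thesis using q[of "(x \<bullet> P y) / (y \<bullet> P y)"]
      by (simp add: field_simps power2_eq_square)
  qed
qed

text \<open>Cauchy-Schwarz for the form at \<open>P x\<close> and \<open>x\<close> bounds the fourth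
  power of \<open>norm (P x)\<close> by zero.\<close>

lemma psd_form_zero:
  fixes P :: "'a::real_inner \<Rightarrow> 'a"
  assumes "self_adjoint P" "\<And>x. 0 \<le> x \<bullet> P x" "x \<bullet> P x = 0"
  shows "P x = 0"
  using psd_form_cauchy_schwarz[OF assms(1,2), of "P x" x] assms(3) by simp

text \<open>Eigenvectors for different eigenvalues are orthogonal. Finiteness is what makes
  \<open>Min\<close> and \<open>Max\<close> of the spectrum meaningful.\<close>

lemma finite_eigenvalues:
  fixes T :: "'a::euclidean_space \<Rightarrow> 'a"
  assumes "self_adjoint T"
  shows "finite (eigenvalues T)"
proof -
  define g where "g l = (SOME v. v \<noteq> 0 \<and> T v = l *\<^sub>R v)" for l
  have g: "g l \<noteq> 0" "T (g l) = l *\<^sub>R g l" if "l \<in> eigenvalues T" for l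
    using someI_ex[of "\<lambda>v. v \<noteq> 0 \<and> T v = l *\<^sub>R v"] that
    by (auto simp: g_def eigenvalues_def)
  have orth: "g l \<bullet> g m = 0" if "l \<in> eigenvalues T" "m \<in> eigenvalues T" "l \<noteq> m" for l m
  proof -
    have "T (g l) \<bullet> g m = g l \<bullet> T (g m)" using assms by (auto simp: self_adjoint_def)
    then show ?thesis using that g by simp
  qed
  have "inj_on g (eigenvalues T)"
    using g(1) orth by (force simp: inj_on_def)
  moreover have "finite (g ` eigenvalues T)"
    using g(1) orth
    by (intro pairwise_orthogonal_imp_finite)
      (auto simp: pairwise_def orthogonal_def)
  ultimately show ?thesis using finite_imageD by blast
qed

text \<open>Let \<open>l\<close> be the maximum of the form on the unit sphere, attained at
  \<open>v\<close>. Then \<open>l - T\<close> is positive semidefinite and its form vanishes at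
  \<open>v\<close>, so \<open>v\<close> lies in its kernel.\<close>

lemma exists_max_rayleigh:
  fixes T :: "'a::euclidean_space \<Rightarrow> 'a"
  assumes "self_adjoint T"
  obtains l where "l \<in> eigenvalues T" "\<And>x. x \<bullet> T x \<le> l * (norm x)\<^sup>2"
proof -
  have lin: "linear T" using assms by (simp add: self_adjoint_def)
  have cont: "continuous_on (sphere 0 1) (\<lambda>x. x \<bullet> T x)"
    by (intro continuous_intros linear_continuous_on)
      (use lin in \<open>simp add: linear_conv_bounded_linear\<close>)
  obtain e :: 'a where "norm e = 1" using vector_choose_size[of 1] by auto
  then have ne: "sphere 0 1 \<noteq> ({} :: 'a set)" by (force intro: exI[of _ e])
  obtain v where v: "norm v = 1" "\<And>x. norm x = 1 \<Longrightarrow> x \<bullet> T x \<le> v \<bullet> T v"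
    using continuous_attains_sup[OF compact_sphere ne cont] by auto
  define l where "l = v \<bullet> T v"
  have bound: "x \<bullet> T x \<le> l * (norm x)\<^sup>2" for x
  proof (cases "x = 0")
    case False
    then have "sgn x \<bullet> T (sgn x) \<le> l"
      unfolding l_def by (intro v) (simp add: norm_sgn)
    moreover have "sgn x \<bullet> T (sgn x) = (x \<bullet> T x) / (norm x)\<^sup>2"
      by (simp add: sgn_div_norm linear_scale[OF lin] power2_eq_square divide_simps)
    ultimately show ?thesis using False by (simp add: divide_simps)
  qed simp
  define P where "P x = l *\<^sub>R x - T x" for x
  have "self_adjoint P"
    using assms unfolding self_adjoint_def P_def
    by (auto simp: inner_diff_left inner_diff_right intro!: linear_compose_sub linear_compose_scale_right linear_id[unfolded id_def])
  moreover have "0 \<le> x \<bullet> P x" for x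
    using bound[of x] by (simp add: P_def inner_diff_right power2_norm_eq_inner)
  moreover have "v \<bullet> P v = 0"
    using v(1) by (simp add: P_def inner_diff_right l_def norm_eq_1)
  ultimately have "P v = 0" by (rule psd_form_zero)
  then have "l \<in> eigenvalues T"
    using v(1) by (auto simp: eigenvalues_def P_def intro!: exI[of _ v])
  then show thesis using bound by (rule that)
qed

lemma rayleigh_le_max_eigenvalue:
  fixes T :: "'a::euclidean_space \<Rightarrow> 'a"
  assumes "self_adjoint T"
  shows "x \<bullet> T x \<le> max_eigenvalue T * (norm x)\<^sup>2"
proof -
  obtain l where l: "l \<in> eigenvalues T" "x \<bullet> T x \<le> l * (norm x)\<^sup>2"
    using exists_max_rayleigh[OF assms] by metis
  have "l \<le> max_eigenvalue T"
    unfolding max_eigenvalue_def using l(1) finite_eigenvalues[OF assms] by (rule Max_ge[rotated])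
  then show ?thesis using l(2) by (meson mult_right_mono order_trans zero_le_power2)
qed

lemma exists_min_rayleigh:
  fixes T :: "'a::euclidean_space \<Rightarrow> 'a"
  assumes "self_adjoint T"
  obtains l where "l \<in> eigenvalues T" "\<And>x. l * (norm x)\<^sup>2 \<le> x \<bullet> T x"
proof -
  have "self_adjoint (\<lambda>x. - T x)"
    using assms by (auto simp: self_adjoint_def intro: linear_compose_neg)
  then obtain l where l: "l \<in> eigenvalues (\<lambda>x. - T x)" "\<And>x. x \<bullet> - T x \<le> l * (norm x)\<^sup>2"
    using exists_max_rayleigh by blast
  have "- l \<in> eigenvalues T"
    using l(1) by (auto simp: eigenvalues_def) (metis minus_equation_iff)
  moreover have "- l * (norm x)\<^sup>2 \<le> x \<bullet> T x" for x using l(2)[of x] by simp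
  ultimately show thesis by (rule that)
qed

lemma min_eigenvalue_le_rayleigh:
  fixes T :: "'a::euclidean_space \<Rightarrow> 'a"
  assumes "self_adjoint T"
  shows "min_eigenvalue T * (norm x)\<^sup>2 \<le> x \<bullet> T x"
proof -
  obtain l where l: "l \<in> eigenvalues T" "l * (norm x)\<^sup>2 \<le> x \<bullet> T x"
    using exists_min_rayleigh[OF assms] by metis
  have "min_eigenvalue T \<le> l"
    unfolding min_eigenvalue_def using l(1) finite_eigenvalues[OF assms] by (rule Min_le[rotated])
  then show ?thesis using l(2) by (meson mult_right_mono order_trans zero_le_power2)
qed

lemma min_eigenvalue_in:
  fixes T :: "'a::euclidean_space \<Rightarrow> 'a"
  assumes "self_adjoint T"
  shows "min_eigenvalue T \<in> eigenvalues T"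
  unfolding min_eigenvalue_def
  using exists_min_rayleigh[OF assms] finite_eigenvalues[OF assms] by (metis Min_in empty_iff)

text \<open>Since \<open>T\<close> is onto, \<open>T \<circ> adjoint T\<close> is positive definite.
  Its least eigenvalue \<open>m\<close> is also one of \<open>adjoint T \<circ> T\<close>, so
  \<open>sigma_min T\<close> is at most \<open>sqrt m\<close>, and the Rayleigh bound for
  \<open>m\<close> gives the estimates. The preimage is the least-norm one, taken in the range of
  \<open>adjoint T\<close>.\<close>

lemma surj_linear_sigma_min:
  fixes T :: "'a::euclidean_space \<Rightarrow> 'b::euclidean_space"
  assumes lin: "linear T" and surj: "surj T"
  shows sigma_min_pos: "0 < sigma_min T"
    and sigma_min_le_adjoint: "sigma_min T * norm w \<le> norm (adjoint T w)"
    and sigma_min_preimage: "\<exists>x. T x = w \<and> sigma_min T * norm x \<le> norm w"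
proof -
  let ?G = "T \<circ> adjoint T"
  have G: "v \<bullet> ?G w = adjoint T v \<bullet> adjoint T w" for v w
    using adjoint_eq[OF lin, of "adjoint T w" v] by (simp add: inner_commute)
  have linG: "linear ?G" by (rule linear_compose[OF linear_adjoint[OF lin] lin])
  have sa: "self_adjoint ?G"
    unfolding self_adjoint_def using linG G by (metis inner_commute)
  have inj: "v = 0" if "adjoint T v = 0" for v
    using surj adjoint_eq[OF lin, of _ v] that
    by (metis inner_eq_zero_iff inner_zero_right surj_def)
  obtain m where m: "m \<in> eigenvalues ?G" "\<And>x. m * (norm x)\<^sup>2 \<le> x \<bullet> ?G x"
    using exists_min_rayleigh[OF sa] by blast
  obtain v where v: "v \<noteq> 0" "?G v = m *\<^sub>R v" using m(1) by (auto simp: eigenvalues_def)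
  have "m * (v \<bullet> v) = adjoint T v \<bullet> adjoint T v" using G[of v v] v(2) by simp
  moreover have "0 < adjoint T v \<bullet> adjoint T v" "0 < v \<bullet> v" using inj v(1) by auto
  ultimately have "m > 0" by (metis zero_less_mult_pos2)
  \<comment> \<open>Applying \<open>adjoint T\<close> turns an eigenpair of \<open>?G\<close> into
    one of \<open>adjoint T \<circ> T\<close>.\<close>
  have "(adjoint T \<circ> T) (adjoint T v) = m *\<^sub>R adjoint T v"
    using v(2) linear_scale[OF linear_adjoint[OF lin]] by simp
  then have "sqrt m \<in> singular_values T"
    using inj v(1) unfolding singular_values_def eigenvalues_def by blast
  then have mem: "sqrt m \<in> {s \<in> singular_values T. 0 < s}" using \<open>m > 0\<close> by simp
  have fin: "finite {s \<in> singular_values T. 0 < s}"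
    using finite_eigenvalues[OF self_adjoint_gram[OF lin]] by (simp add: singular_values_def)
  show pos: "0 < sigma_min T"
    using Min_in[OF fin] mem unfolding sigma_min_def by blast
  have le: "sigma_min T \<le> sqrt m"
    unfolding sigma_min_def by (rule Min_le[OF fin mem])
  have low: "sigma_min T * norm w \<le> norm (adjoint T w)" for w
  proof (rule power2_le_imp_le)
    have "(sigma_min T)\<^sup>2 \<le> m" using le pos by (metis \<open>m > 0\<close> less_imp_le power_mono real_sqrt_pow2)
    then have "(sigma_min T)\<^sup>2 * (norm w)\<^sup>2 \<le> m * (norm w)\<^sup>2" by (rule mult_right_mono) simp
    also have "\<dots> \<le> w \<bullet> ?G w" by (rule m(2))
    finally show "(sigma_min T * norm w)\<^sup>2 \<le> (norm (adjoint T w))\<^sup>2"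
      unfolding G by (simp add: power_mult_distrib power2_norm_eq_inner)
  qed simp
  then show "sigma_min T * norm w \<le> norm (adjoint T w)" .
  have "inj ?G"
  proof (subst linear_injective_0[OF linG], intro allI impI)
    fix p assume "?G p = 0"
    then have "adjoint T p \<bullet> adjoint T p = 0" using G[of p p] by simp
    then show "p = 0" using inj by simp
  qed
  then have "surj ?G" using linG linear_injective_imp_surjective by blast
  then obtain p where p: "w = ?G p" by (rule surjE)
  have "(norm (adjoint T p))\<^sup>2 = p \<bullet> w" by (simp add: p G power2_norm_eq_inner del: o_apply)
  also have "\<dots> \<le> norm p * norm w" by (rule norm_cauchy_schwarz)
  finally have "sigma_min T * (norm (adjoint T p))\<^sup>2 \<le> sigma_min T * (norm p * norm w)"
    using pos by simp
  \<comment> \<open>The lower bound at \<open>p\<close> trades \<open>norm p\<close> for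
    \<open>norm (adjoint T p)\<close>, one factor of which cancels afterwards.\<close>
  also have "\<dots> \<le> norm (adjoint T p) * norm w"
    using mult_right_mono[OF low[of p], of "norm w"] by (simp add: mult_ac)
  finally have "sigma_min T * norm (adjoint T p) \<le> norm w"
    by (cases "adjoint T p = 0") (auto simp: power2_eq_square)
  then show "\<exists>x. T x = w \<and> sigma_min T * norm x \<le> norm w"
    using p by (intro exI[of _ "adjoint T p"]) simp
qed

subsection \<open>The positive semidefinite cone\<close>

lemma self_adjoint_mat_of: "self_adjoint (\<lambda>v. mat_of X *v v)"
  unfolding self_adjoint_def
  by (metis dot_lmul_matrix matrix_vector_mul_linear transpose_mat_of transpose_matrix_vector)

lemma quadratic_form_add:
  "v \<bullet> (mat_of (X + Y) *v v) = v \<bullet> (mat_of X *v v) + v \<bullet> (mat_of Y *v v)"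
  by (simp add: mat_of_add matrix_vector_mult_add_rdistrib inner_add_right)

text \<open>The rank-one matrix v v^T. Pairing with it makes the quadratic form linear in the
  matrix, so that the cone is an intersection of half-spaces.\<close>

definition outer :: "real^'n \<Rightarrow> 'n::finite symmat" where
  "outer v = Symmat (\<chi> i j. v $ i * v $ j)"

lemma mat_of_outer: "mat_of (outer v) = (\<chi> i j. v $ i * v $ j)"
  unfolding outer_def by (rule mat_of_Symmat) (simp add: transpose_def vec_eq_iff mult.commute)

lemma outer_mult_vec: "mat_of (outer v) *v x = (v \<bullet> x) *\<^sub>R v"
  by (simp add: mat_of_outer matrix_vector_mult_def inner_vec_def vec_eq_iff sum_distrib_left
      mult_ac)

lemma inner_outer: "X \<bullet> outer v = v \<bullet> (mat_of X *v v)"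
  by (simp add: inner_symmat_eq mat_of_outer inner_vec_def matrix_vector_mult_def
      sum_distrib_left mult_ac)

lemma norm_outer: "norm (outer v) = (norm v)\<^sup>2"
  by (simp add: norm_eq_sqrt_inner[of "outer v"] inner_outer outer_mult_vec power2_norm_eq_inner)

lemma abs_quadratic_form_le: "\<bar>v \<bullet> (mat_of X *v v)\<bar> \<le> norm X * (norm v)\<^sup>2"
  using Cauchy_Schwarz_ineq2[of X "outer v"] by (simp add: inner_outer norm_outer)

lemma psd_cone_iff: "X \<in> psd_cone \<longleftrightarrow> (\<forall>v. 0 \<le> X \<bullet> outer v)"
  by (simp add: psd_cone_def inner_outer)

lemma closed_psd_cone: "closed (psd_cone :: 'n::finite symmat set)"
proof -
  have "psd_cone = (\<Inter>v\<in>UNIV. {X :: 'n symmat. 0 \<le> outer v \<bullet> X})"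
    by (auto simp: psd_cone_iff inner_commute)
  also have "closed \<dots>"
    using closed_halfspace_ge[where a = "outer _" and b = 0] by (intro closed_INT ballI) simp
  finally show ?thesis .
qed

lemma psd_cone_add: "X \<in> psd_cone \<Longrightarrow> Y \<in> psd_cone \<Longrightarrow> X + Y \<in> psd_cone"
  by (simp add: psd_cone_iff inner_add_left)

lemma psd_cone_scaleR: "X \<in> psd_cone \<Longrightarrow> 0 \<le> r \<Longrightarrow> r *\<^sub>R X \<in> psd_cone"
  by (simp add: psd_cone_iff)

lemma zero_in_psd_cone: "0 \<in> psd_cone"
  by (simp add: psd_cone_iff)

lemma convex_psd_cone: "convex psd_cone"
  by (simp add: convex_def psd_cone_add psd_cone_scaleR)

text \<open>Removing a rank-one Schur complement term from \<open>X\<close> enlarges its kernel.\<close>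

lemma inner_psd_nonneg:
  fixes X Y :: "'n::finite symmat"
  assumes "X \<in> psd_cone" "Y \<in> psd_cone"
  shows "0 \<le> X \<bullet> Y"
  using assms(1)
\<comment> \<open>The measure is the rank of \<open>X\<close>.\<close>
proof (induction "CARD('n) - dim {v. mat_of X *v v = 0}" arbitrary: X rule: less_induct)
  case less
  let ?ker = "\<lambda>X :: 'n symmat. {v. mat_of X *v v = 0}"
  have nonneg: "0 \<le> v \<bullet> (mat_of X *v v)" for v using less.prems by (simp add: psd_cone_def)
  show ?case
  proof (cases "\<exists>v. v \<bullet> (mat_of X *v v) \<noteq> 0")
    case False
    then have "X \<bullet> X = 0 \<or> mat_of X = 0"
      using psd_form_zero[OF self_adjoint_mat_of nonneg] by (metis matrix_eq matrix_vector_mult_0)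
    then show ?thesis by (auto simp: inner_symmat_eq)
  next
    case True
    then obtain v where v: "0 < v \<bullet> (mat_of X *v v)" using nonneg by (metis less_eq_real_def)
    define a where "a = v \<bullet> (mat_of X *v v)"
    define p where "p = mat_of X *v v"
    have "a > 0" using v by (simp add: a_def)
    define X' where "X' = X - inverse a *\<^sub>R outer p"
    have p: "p \<bullet> x = v \<bullet> (mat_of X *v x)" for x
      using self_adjoint_mat_of[of X] by (simp add: p_def self_adjoint_def)
    have mX': "mat_of X' *v x = mat_of X *v x - (inverse a * (p \<bullet> x)) *\<^sub>R p" for x
      by (simp add: X'_def mat_of_diff mat_of_scaleR matrix_vector_mult_diff_rdistrib
          outer_mult_vec scaleR_matrix_vector_assoc[symmetric])
    have X'psd: "X' \<in> psd_cone"
      unfolding psd_cone_def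
    proof (intro CollectI allI)
      fix x
      \<comment> \<open>Positivity of \<open>X'\<close> is Cauchy-Schwarz for the form of
        \<open>X\<close> at \<open>x\<close> and \<open>v\<close>.\<close>
      have "(x \<bullet> p)\<^sup>2 \<le> (x \<bullet> (mat_of X *v x)) * a"
        unfolding p_def a_def by (rule psd_form_cauchy_schwarz[OF self_adjoint_mat_of nonneg])
      then show "0 \<le> x \<bullet> (mat_of X' *v x)"
        using \<open>a > 0\<close> by (simp add: mX' inner_diff_right inner_commute power2_eq_square field_simps)
    qed
    have sub: "subspace (?ker X)" for X :: "'n symmat"
      by (rule subspaceI)
        (auto simp: matrix_vector_right_distrib matrix_vector_mult_scaleR)
    have "?ker X \<subseteq> ?ker X'" by (auto simp: mX' p)
    \<comment> \<open>The kernel gains \<open>v\<close>: as \<open>p \<bullet> v = a\<close>, the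
      removed term at \<open>v\<close> is \<open>p\<close>, which is
      \<open>mat_of X *v v\<close>.\<close>
    moreover have "v \<in> ?ker X'"
      using \<open>a > 0\<close> by (simp add: mX' inner_commute[of p v]) (simp add: p_def a_def)
    moreover have "v \<notin> ?ker X" using v by auto
    ultimately have "?ker X \<subset> ?ker X'" by blast
    then have "dim (?ker X) < dim (?ker X')" using sub by (metis dim_psubset span_eq_iff)
    moreover have "dim (?ker X') \<le> CARD('n)" using dim_subset_UNIV[of "?ker X'"] by simp
    ultimately have "0 \<le> X' \<bullet> Y" by (intro less.hyps X'psd) simp
    moreover have "X \<bullet> Y = X' \<bullet> Y + inverse a * (Y \<bullet> outer p)"
      by (simp add: X'_def inner_diff_left inner_commute[of Y])
    moreover have "0 \<le> inverse a * (Y \<bullet> outer p)"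
      using \<open>a > 0\<close> assms(2) by (simp add: psd_cone_iff)
    ultimately show ?thesis by linarith
  qed
qed

section \<open>Projection onto the cone\<close>

lemma closest_point_psd_in: "closest_point psd_cone P \<in> psd_cone"
  using closest_point_in_set[OF closed_psd_cone] zero_in_psd_cone by blast

text \<open>This is the variational inequality for the residual \<open>- N\<close>: orthogonality
  removes \<open>X\<close>, and \<open>inner_psd_nonneg\<close> gives \<open>Y \<bullet> N\<close>
  its sign.\<close>

lemma moreau_psd:
  assumes "X \<in> psd_cone" "N \<in> psd_cone" "X \<bullet> N = 0"
  shows "closest_point psd_cone (X - N) = X"
proof (rule closest_point_unique[OF convex_psd_cone closed_psd_cone assms(1), symmetric], rule ballI)
  fix Y :: "'a symmat" assume Y: "Y \<in> psd_cone"
  have "0 \<le> Y \<bullet> N" using Y assms(2) by (rule inner_psd_nonneg)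
  then have "(X - N - X) \<bullet> (Y - X) \<le> 0"
    using assms(3) by (simp add: inner_diff_right inner_diff_left inner_commute)
  then have "0 \<le> (norm (X - N - Y))\<^sup>2 - (norm (X - N - X))\<^sup>2"
    using zero_le_power2[of "norm (Y - X)"]
    unfolding power2_norm_eq_inner by (simp add: inner_simps inner_commute)
  then show "dist (X - N) X \<le> dist (X - N) Y"
    by (simp add: dist_norm power2_norm_eq_inner norm_le)
qed

text \<open>The variational inequality of the projection \<open>X\<close>, tested at
  \<open>0\<close> and \<open>2 X\<close>, gives orthogonality; tested at
  \<open>X + outer v\<close>, it makes \<open>X - P\<close> positive semidefinite.\<close>

lemma moreau_psd_decomposition:
  fixes P :: "'n::finite symmat"
  obtains X N where "X \<in> psd_cone" "N \<in> psd_cone" "X \<bullet> N = 0" "P = X - N"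
proof -
  define X where "X = closest_point psd_cone P"
  have X: "X \<in> psd_cone" unfolding X_def by (rule closest_point_psd_in)
  have var: "(P - X) \<bullet> (Y - X) \<le> 0" if "Y \<in> psd_cone" for Y
    unfolding X_def using closest_point_dot[OF convex_psd_cone closed_psd_cone that] .
  have "(P - X) \<bullet> X = 0"
    using var[OF zero_in_psd_cone] var[OF psd_cone_scaleR[OF X, of 2]]
    by (simp add: inner_simps)
  moreover have "X - P \<in> psd_cone"
    unfolding psd_cone_iff
  proof
    fix v :: "real^'n"
    have "outer v \<in> psd_cone"
      by (simp add: psd_cone_def outer_mult_vec inner_commute)
    from var[OF psd_cone_add[OF X this]] show "0 \<le> (X - P) \<bullet> outer v"
      by (simp add: inner_diff_left)
  qed
  ultimately show thesis
    by (intro that[OF X, of "X - P"]) (simp_all add: inner_diff_left inner_diff_right inner_commute[of P X])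
qed

text \<open>The least eigenvalue has an eigenvector, hence is positive. A perturbation changes the
  Rayleigh quotient by at most its Frobenius norm, so a ball of that radius stays in the
  cone.\<close>

lemma pos_def_lambda_min:
  fixes X :: "'n::finite symmat"
  assumes "pos_def X"
  shows lambda_min_pos: "0 < lambda_min X"
    and pos_def_perturb: "\<And>V. norm V \<le> lambda_min X \<Longrightarrow> X + V \<in> psd_cone"
proof -
  obtain v where v: "v \<noteq> 0" "mat_of X *v v = lambda_min X *\<^sub>R v"
    using min_eigenvalue_in[OF self_adjoint_mat_of, of X]
    unfolding eigenvalues_def lambda_min_def by blast
  have "0 < lambda_min X * (v \<bullet> v)" using assms v unfolding pos_def_def by force
  then show "0 < lambda_min X" by (rule zero_less_mult_pos2) (use v(1) in simp)
  fix V :: "'n symmat" assume V: "norm V \<le> lambda_min X"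
  show "X + V \<in> psd_cone"
    unfolding psd_cone_def
  proof (intro CollectI allI)
    fix x :: "real^'n"
    have "norm V * (norm x)\<^sup>2 \<le> lambda_min X * (norm x)\<^sup>2" using V by (rule mult_right_mono) simp
    also have "\<dots> \<le> x \<bullet> (mat_of X *v x)"
      unfolding lambda_min_def by (rule min_eigenvalue_le_rayleigh[OF self_adjoint_mat_of])
    finally show "0 \<le> x \<bullet> (mat_of (X + V) *v x)"
      using abs_quadratic_form_le[of x V] by (simp add: quadratic_form_add)
  qed
qed

subsection \<open>The augmented Lagrangian and the proximal objective\<close>

text \<open>The maximizer is \<open>d + v\<close>; the deficit at \<open>w\<close> is half the
  square of \<open>norm (w - d - v)\<close>.\<close>

lemma conjugate_least_sq: "conjugate (least_sq d) v = v \<bullet> d + 1/2 * (norm v)\<^sup>2"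
  unfolding conjugate_def
proof (rule cSup_eq_maximum)
  show "v \<bullet> d + 1/2 * (norm v)\<^sup>2 \<in> range (\<lambda>w. v \<bullet> w - least_sq d w)"
    by (rule range_eqI[of _ _ "d + v"])
      (simp add: least_sq_def inner_add_right power2_norm_eq_inner)
next
  fix a assume "a \<in> range (\<lambda>w. v \<bullet> w - least_sq d w)"
  then obtain w where a: "a = v \<bullet> w - least_sq d w" by blast
  have "0 \<le> (norm (w - d - v))\<^sup>2" by simp
  then show "a \<le> v \<bullet> d + 1/2 * (norm v)\<^sup>2"
    unfolding a least_sq_def power2_norm_eq_inner
    by (simp add: inner_simps inner_commute field_simps)
qed

locale least_squares_sdp =
  fixes A :: "'n::finite symmat \<Rightarrow> 'y::euclidean_space"
    and F :: "'n symmat \<Rightarrow> 'w::real_inner"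
    and C Xk :: "'n symmat" and b :: 'y and d :: 'w and c :: real
  assumes linear_A: "linear A" and linear_F: "linear F" and c_pos: "c > 0"
begin

abbreviation L where "L \<equiv> aug_lagrangian (least_sq d) F C A b c Xk"
abbreviation L_inf where "L_inf \<equiv> inf_aug_lagrangian (least_sq d) F C A b c Xk"
abbreviation f where "f \<equiv> prox_objective (least_sq d) F C c Xk"
abbreviation feasible where "feasible \<equiv> primal_feasible A b"
abbreviation residual where "residual y w S \<equiv> adjoint A y + adjoint F w + S - C"

text \<open>Closed form of the gradient of \<open>f\<close>; \<open>gradient_f\<close> identifies it
  with the definite description \<open>gradient f\<close>.\<close>

definition grad where
  "grad X = - adjoint F (F X - d) - C - inverse c *\<^sub>R (X - Xk)"

text \<open>Two squares are completed: the least squares term at \<open>F X\<close>, its conjugate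
  at \<open>- w\<close> and \<open>F X \<bullet> w\<close> make the first, the penalty and the
  proximal term the second. Eliminating \<open>C\<close> moves \<open>y\<close> and \<open>w\<close>
  through the adjoints.\<close>

lemma lagrangian_gap:
  "L (y, w, S) - f X = (A X - b) \<bullet> y + 1/2 * (norm (w + F X - d))\<^sup>2 + X \<bullet> S
     + (norm (Xk + c *\<^sub>R residual y w S - X))\<^sup>2 / (2 * c)"
proof -
  define N where "N = residual y w S"
  have C: "C = adjoint A y + adjoint F w + S - N" by (simp add: N_def)
  have CX: "C \<bullet> X = A X \<bullet> y + F X \<bullet> w + X \<bullet> S - X \<bullet> N"
    by (subst C) (simp add: inner_simps adjoint_eq[OF linear_A] adjoint_eq[OF linear_F]
        inner_commute[of X])
  have sq: "(norm (Xk + c *\<^sub>R N - X))\<^sup>2 / (2 * c)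
      = (norm (X - Xk))\<^sup>2 / (2 * c) + Xk \<bullet> N - X \<bullet> N + c / 2 * (norm N)\<^sup>2"
    using c_pos unfolding power2_norm_eq_inner
    by (simp add: inner_simps inner_commute field_simps power2_eq_square)
  show ?thesis
    unfolding aug_lagrangian_def prox_objective_def least_sq_def conjugate_least_sq prod.case
      N_def[symmetric] CX sq
    unfolding power2_norm_eq_inner by (simp add: inner_simps inner_commute field_simps)
qed

text \<open>The Lagrangian is quadratic in \<open>(y, w)\<close>, so this expansion is exact. Its
  partial gradients are \<open>A X - b\<close> and \<open>w + F X - d\<close> at the multiplier
  update \<open>X\<close> before projection.\<close>

lemma lagrangian_step:
  fixes y p :: 'y and w q :: 'w and S :: "'n symmat"
  defines "X \<equiv> Xk + c *\<^sub>R residual y w S"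
  shows "L (y + p, w + q, S) = L (y, w, S) + (A X - b) \<bullet> p + (w + F X - d) \<bullet> q
     + 1/2 * (norm q)\<^sup>2 + c / 2 * (norm (adjoint A p + adjoint F q))\<^sup>2"
proof -
  define N where "N = residual y w S"
  define e where "e = adjoint A p + adjoint F q"
  have N': "residual (y + p) (w + q) S = N + e"
    by (simp add: N_def e_def linear_add[OF linear_adjoint] linear_A linear_F)
  have X: "A X \<bullet> p + F X \<bullet> q = Xk \<bullet> e + c * (N \<bullet> e)"
    unfolding X_def N_def[symmetric]
    by (simp add: e_def adjoint_eq[OF linear_A] adjoint_eq[OF linear_F] inner_simps algebra_simps)
  show ?thesis
    unfolding aug_lagrangian_def conjugate_least_sq prod.case N' N_def[symmetric] e_def[symmetric]
    using X unfolding power2_norm_eq_inner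
    by (simp add: inner_simps inner_commute field_simps)
qed

text \<open>Every term of the gap identity is nonnegative, and the one with \<open>y\<close>
  vanishes.\<close>

lemma weak_duality:
  assumes "X \<in> feasible" "z \<in> dual_domain"
  shows "f X \<le> L z"
proof -
  obtain y w S where z: "z = (y, w, S)" by (cases z)
  have "0 \<le> X \<bullet> S"
    using assms by (auto simp: z dual_domain_def primal_feasible_def intro: inner_psd_nonneg)
  then have "0 \<le> L (y, w, S) - f X"
    using assms(1) c_pos unfolding lagrangian_gap by (simp add: primal_feasible_def)
  then show ?thesis by (simp add: z)
qed

text \<open>A real \<open>INF\<close> is a lower bound only for a set bounded below, which a
  feasible point guarantees.\<close>

lemma L_inf_le:
  assumes "feasible \<noteq> {}" "z \<in> dual_domain"
  shows "L_inf \<le> L z"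
proof -
  obtain X where "X \<in> feasible" using assms(1) by blast
  then have "bdd_below (L ` dual_domain)" by (intro bdd_belowI2[of _ "f X"] weak_duality)
  then show ?thesis unfolding inf_aug_lagrangian_def using assms(2) by (rule cINF_lower)
qed

lemma le_L_inf: "X \<in> feasible \<Longrightarrow> f X \<le> L_inf"
  unfolding inf_aug_lagrangian_def
  by (rule cINF_greatest) (use zero_in_psd_cone in \<open>auto simp: dual_domain_def intro!: weak_duality\<close>)

text \<open>Split the argument of the projection as \<open>P = Y - N\<close> by Moreau. Then
  \<open>X = Y\<close>, while \<open>S\<close> projects \<open>- P / c\<close> and equals
  \<open>N / c\<close>; adding \<open>c S\<close> to \<open>P\<close> gives back
  \<open>Y\<close>.\<close>

lemma moreau_slack:
  fixes y :: 'y and w :: 'w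
  defines "S \<equiv> dual_slack F C A c Xk y w"
    and "X \<equiv> closest_point psd_cone (Xk + c *\<^sub>R (adjoint A y + adjoint F w - C))"
  shows "S \<in> psd_cone" "X \<in> psd_cone" "X \<bullet> S = 0" "Xk + c *\<^sub>R residual y w S = X"
proof -
  define P where "P = Xk + c *\<^sub>R (adjoint A y + adjoint F w - C)"
  obtain Y N where YN: "Y \<in> psd_cone" "N \<in> psd_cone" "Y \<bullet> N = 0" "P = Y - N"
    by (rule moreau_psd_decomposition)
  have X: "X = Y"
    unfolding X_def P_def[symmetric] YN(4) using YN by (intro moreau_psd)
  have "C - adjoint A y - adjoint F w - inverse c *\<^sub>R Xk = - (inverse c *\<^sub>R P)"
    using c_pos by (simp add: P_def scaleR_add_right scaleR_diff_right)
  also have "\<dots> = inverse c *\<^sub>R N - inverse c *\<^sub>R Y"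
    by (simp add: YN(4) scaleR_diff_right)
  finally have S: "S = inverse c *\<^sub>R N"
    unfolding S_def dual_slack_def using YN c_pos
    by (simp add: moreau_psd psd_cone_scaleR inner_commute)
  show "S \<in> psd_cone" "X \<in> psd_cone" "X \<bullet> S = 0"
    using YN c_pos by (simp_all add: X S psd_cone_scaleR)
  have "Xk + c *\<^sub>R residual y w S = P + N"
    using c_pos by (simp add: P_def S scaleR_add_right scaleR_diff_right)
  then show "Xk + c *\<^sub>R residual y w S = X" by (simp add: X YN(4))
qed

text \<open>One step of gradient descent in \<open>(y, w)\<close> with \<open>S\<close> held fixed, along which \<open>L\<close> is quadratic.\<close>

lemma gradient_norm_le_gap:
  assumes "feasible \<noteq> {}"
  obtains K where "\<And>y w S. S \<in> psd_cone \<Longrightarrow>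
    (norm (A (Xk + c *\<^sub>R residual y w S) - b))\<^sup>2 + (norm (w + F (Xk + c *\<^sub>R residual y w S) - d))\<^sup>2
      \<le> K * (L (y, w, S) - L_inf)"
proof -
  obtain K1 where K1: "K1 \<ge> 0" "\<And>p. norm (adjoint A p) \<le> K1 * norm p"
    using adjoint_bounded[OF linear_A] by blast
  obtain K2 where K2: "K2 \<ge> 0" "\<And>q. norm (adjoint F q) \<le> K2 * norm q"
    using adjoint_bounded[OF linear_F] by blast
  \<comment> \<open>Bounds the curvature of \<open>L\<close> in \<open>(y, w)\<close>: 1 comes from
    the conjugate, the rest from the penalty via
    \<open>(a + b)^2 \<le> 2 a^2 + 2 b^2\<close>.\<close>
  define m where "m = 1 + 2 * c * (K1\<^sup>2 + K2\<^sup>2)"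
  have m: "m > 0" unfolding m_def using c_pos by (intro add_pos_nonneg) auto
  show thesis
  proof (rule that[of "2 * m"])
    fix y w and S :: "'n symmat" assume S: "S \<in> psd_cone"
    define X where "X = Xk + c *\<^sub>R residual y w S"
    define u where "u = A X - b"
    define r where "r = w + F X - d"
    \<comment> \<open>This step length minimizes the quadratic upper bound and gains half of
      \<open>s\<close> times the squared gradient norm.\<close>
    define s where "s = inverse m"
    let ?e = "adjoint A (- s *\<^sub>R u) + adjoint F (- s *\<^sub>R r)"
    have "norm ?e \<le> K1 * norm (s *\<^sub>R u) + K2 * norm (s *\<^sub>R r)"
      using norm_triangle_ineq[of "adjoint A (- s *\<^sub>R u)" "adjoint F (- s *\<^sub>R r)"]
        K1(2)[of "- s *\<^sub>R u"] K2(2)[of "- s *\<^sub>R r"] by simp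
    then have "(norm ?e)\<^sup>2 \<le> (K1 * norm (s *\<^sub>R u) + K2 * norm (s *\<^sub>R r))\<^sup>2"
      by (rule power_mono) simp
    also have "\<dots> \<le> 2 * (K1 * norm (s *\<^sub>R u))\<^sup>2 + 2 * (K2 * norm (s *\<^sub>R r))\<^sup>2"
      using sum_squares_bound[of "K1 * norm (s *\<^sub>R u)" "K2 * norm (s *\<^sub>R r)"]
      by (simp add: power2_sum)
    also have "\<dots> = 2 * s\<^sup>2 * (K1\<^sup>2 * (norm u)\<^sup>2 + K2\<^sup>2 * (norm r)\<^sup>2)"
      by (simp add: power_mult_distrib algebra_simps)
    also have "\<dots> \<le> 2 * s\<^sup>2 * ((K1\<^sup>2 + K2\<^sup>2) * ((norm u)\<^sup>2 + (norm r)\<^sup>2))"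
      by (intro mult_left_mono) (auto simp: algebra_simps)
    finally have e: "c / 2 * (norm ?e)\<^sup>2
        \<le> c / 2 * (2 * s\<^sup>2 * ((K1\<^sup>2 + K2\<^sup>2) * ((norm u)\<^sup>2 + (norm r)\<^sup>2)))"
      using c_pos by (intro mult_left_mono) auto
    define G where "G = (norm u)\<^sup>2 + (norm r)\<^sup>2"
    have "L_inf \<le> L (y + - s *\<^sub>R u, w + - s *\<^sub>R r, S)"
      using assms S by (intro L_inf_le) (auto simp: dual_domain_def)
    also have "\<dots> = L (y, w, S) + u \<bullet> (- s *\<^sub>R u) + r \<bullet> (- s *\<^sub>R r)
       + 1/2 * (norm (- s *\<^sub>R r))\<^sup>2 + c / 2 * (norm ?e)\<^sup>2"
      unfolding lagrangian_step X_def[symmetric] u_def r_def by simp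
    also have "\<dots> = L (y, w, S) - s * G + 1/2 * s\<^sup>2 * (norm r)\<^sup>2 + c / 2 * (norm ?e)\<^sup>2"
      by (simp add: G_def power2_norm_eq_inner[symmetric] power_mult_distrib algebra_simps)
    also have "\<dots> \<le> L (y, w, S) - s * G + 1/2 * s\<^sup>2 * G
        + c / 2 * (2 * s\<^sup>2 * ((K1\<^sup>2 + K2\<^sup>2) * G))"
    proof -
      have "1/2 * s\<^sup>2 * (norm r)\<^sup>2 \<le> 1/2 * s\<^sup>2 * G"
        by (intro mult_left_mono) (auto simp: G_def)
      then show ?thesis using e unfolding G_def by linarith
    qed
    also have "\<dots> = L (y, w, S) - s * G + 1/2 * s * (s * m) * G"
      by (simp add: m_def algebra_simps power2_eq_square)
    also have "s * m = 1" using m by (simp add: s_def)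
    finally have "s * G \<le> 2 * (L (y, w, S) - L_inf)" by (simp add: mult.commute)
    then show "(norm (A X - b))\<^sup>2 + (norm (w + F X - d))\<^sup>2 \<le> 2 * m * (L (y, w, S) - L_inf)"
      using m by (simp add: G_def s_def u_def r_def field_simps)
  qed
qed

section \<open>Calculus of the proximal objective\<close>

lemma bounded_linear_F: "bounded_linear F"
  using linear_F by (simp add: linear_conv_bounded_linear)

lemma bounded_linear_A: "bounded_linear A"
  using linear_A by (simp add: linear_conv_bounded_linear)

lemma continuous_on_f: "continuous_on U f"
  unfolding prox_objective_def least_sq_def
  by (intro continuous_intros bounded_linear.continuous_on[OF bounded_linear_F])
    (use c_pos in simp)

lemma grad_inner: "grad X \<bullet> D = - ((F X - d) \<bullet> F D) - C \<bullet> D - (X - Xk) \<bullet> D / c"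
proof -
  have "adjoint F (F X - d) \<bullet> D = (F X - d) \<bullet> F D"
    by (metis adjoint_eq[OF linear_F] inner_commute)
  then show ?thesis by (simp add: grad_def inner_diff_left divide_inverse algebra_simps)
qed

lemma f_expansion:
  "f (X + D) = f X + grad X \<bullet> D - 1/2 * (norm (F D))\<^sup>2 - (norm D)\<^sup>2 / (2 * c)"
  unfolding prox_objective_def least_sq_def grad_inner linear_add[OF linear_F] power2_norm_eq_inner
  using c_pos by (simp add: inner_simps inner_commute field_simps)

text \<open>The definite description requires uniqueness of the derivative besides its
  existence.\<close>

lemma gradient_f: "gradient f X = grad X"
  unfolding gradient_def
proof (rule the_equality)
  have "(f has_derivative (\<lambda>D. D \<bullet> grad X)) (at X)"
    unfolding prox_objective_def least_sq_def power2_norm_eq_inner inner_commute[of _ "grad X"]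
      grad_inner
    using c_pos
    by (auto intro!: derivative_eq_intros bounded_linear.has_derivative[OF bounded_linear_F]
        simp: fun_eq_iff inner_simps inner_commute field_simps)
  then show G: "GDERIV f X :> grad X" by (simp add: gderiv_def)
  fix g assume "GDERIV f X :> g"
  then have "(\<lambda>D. D \<bullet> g) = (\<lambda>D. D \<bullet> grad X)"
    using G has_derivative_unique unfolding gderiv_def by blast
  then show "g = grad X" by (metis vector_eq_ldot)
qed

text \<open>Compactness of the ball. The bound serves to keep \<open>sqrt t / norm (grad X)\<close>
  away from zero.\<close>

lemma grad_bounded:
  obtains G where "G > 0" "\<And>X. norm X \<le> R \<Longrightarrow> norm (grad X) \<le> G"
proof -
  have "continuous_on (cball 0 R) grad"
    unfolding grad_def
    by (intro continuous_intros bounded_linear.continuous_on[OF bounded_linear_F]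
        bounded_linear.continuous_on[OF bounded_linear_adjoint[OF linear_F]])
  then have "bounded (grad ` cball 0 R)"
    by (intro compact_imp_bounded compact_continuous_image compact_cball)
  then show thesis
    using that unfolding bounded_pos by (auto simp: dist_norm)
qed

text \<open>In the gap identity at \<open>Xhat + V\<close> all terms but the one with
  \<open>y\<close> are nonnegative, so a \<open>V\<close> aligned with \<open>adjoint A y\<close>
  bounds that vector, hence \<open>y\<close> as \<open>A\<close> is onto. At \<open>Xhat\<close>
  itself, the last square bounds the primal point.\<close>

lemma level_set_bounded:
  assumes surj_A: "surj A" and Xhat: "A Xhat = b" "pos_def Xhat"
  obtains R where "\<And>y w S. S \<in> psd_cone \<Longrightarrow> L (y, w, S) \<le> B \<Longrightarrow>
    norm y \<le> R \<and> norm (Xk + c *\<^sub>R residual y w S) \<le> R"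
proof -
  define l where "l = lambda_min Xhat"
  have l: "l > 0" unfolding l_def using Xhat(2) by (rule lambda_min_pos)
  have \<sigma>: "sigma_min A > 0" using linear_A surj_A by (rule sigma_min_pos)
  have "bounded (f ` cball Xhat l)"
    by (intro compact_imp_bounded compact_continuous_image compact_cball continuous_on_f)
  then obtain K where "\<forall>X\<in>cball Xhat l. \<bar>f X\<bar> \<le> K"
    by (auto simp: bounded_iff)
  then have K: "\<bar>f X\<bar> \<le> K" if "dist Xhat X \<le> l" for X
    using that by simp
  show thesis
  \<comment> \<open>The first entry bounds \<open>y\<close>; the second bounds the primal point,
    using \<open>r \<le> 1 + r^2\<close> instead of a square root.\<close>
  proof (rule that[of "max ((B + K) / (l * sigma_min A)) (norm Xhat + 1 + 2 * c * (B - f Xhat))"])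
    fix y w and S :: "'n symmat" assume S: "S \<in> psd_cone" and B: "L (y, w, S) \<le> B"
    define X where "X = Xk + c *\<^sub>R residual y w S"
    \<comment> \<open>\<open>pos_def_perturb\<close> allows the length \<open>l\<close>, and the
      direction makes \<open>A V \<bullet> y\<close> equal to \<open>l * norm (adjoint A y)\<close>;
      \<open>sgn 0 = 0\<close> covers the zero vector.\<close>
    define V where "V = l *\<^sub>R sgn (adjoint A y)"
    have nV: "norm V \<le> l" using l by (simp add: V_def norm_sgn)
    have "0 \<le> (Xhat + V) \<bullet> S"
      using nV S Xhat(2) by (intro inner_psd_nonneg pos_def_perturb) (simp_all add: l_def)
    then have "(A (Xhat + V) - b) \<bullet> y \<le> L (y, w, S) - f (Xhat + V)"
      using c_pos unfolding lagrangian_gap by simp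
    moreover have "\<bar>f (Xhat + V)\<bar> \<le> K" using nV by (intro K) (simp add: dist_norm)
    moreover have "(A (Xhat + V) - b) \<bullet> y = l * norm (adjoint A y)"
      by (simp add: linear_add[OF linear_A] Xhat(1) adjoint_eq[OF linear_A] V_def sgn_div_norm
          power2_norm_eq_inner[symmetric] power2_eq_square divide_simps)
    ultimately have "l * norm (adjoint A y) \<le> B + K" using B by linarith
    then have "l * (sigma_min A * norm y) \<le> B + K"
      using sigma_min_le_adjoint[OF linear_A surj_A, of y] l
      by (meson less_imp_le mult_left_mono order_trans)
    then have y: "norm y \<le> (B + K) / (l * sigma_min A)"
      using l \<sigma> by (simp add: pos_le_divide_eq mult_ac)
    have "Xhat \<in> psd_cone" using pos_def_perturb[OF Xhat(2), of 0] l by (simp add: l_def)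
    then have "0 \<le> Xhat \<bullet> S" using S by (rule inner_psd_nonneg)
    then have "(norm (X - Xhat))\<^sup>2 / (2 * c) \<le> L (y, w, S) - f Xhat"
      unfolding lagrangian_gap X_def using Xhat(1) by simp
    then have "(norm (X - Xhat))\<^sup>2 / (2 * c) \<le> B - f Xhat" using B by linarith
    then have "(norm (X - Xhat))\<^sup>2 \<le> 2 * c * (B - f Xhat)"
      using c_pos by (simp add: field_simps)
    moreover have "norm (X - Xhat) \<le> 1 + (norm (X - Xhat))\<^sup>2"
      using sum_squares_bound[of "norm (X - Xhat)" 1] norm_ge_zero[of "X - Xhat"]
      unfolding power_one mult_1_right by linarith
    moreover have "norm X \<le> norm Xhat + norm (X - Xhat)" by (rule norm_triangle_sub)
    ultimately show "norm y \<le> max ((B + K) / (l * sigma_min A)) (norm Xhat + 1 + 2 * c * (B - f Xhat))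
      \<and> norm X \<le> max ((B + K) / (l * sigma_min A)) (norm Xhat + 1 + 2 * c * (B - f Xhat))"
      using y by linarith
  qed
qed

text \<open>
  The point \<open>Xk\<close> maximizes its own proximal objective only if it maximizes the primal objective:
  along a segment the proximal term is of second order.
\<close>

lemma proximal_improvement:
  assumes "Xk \<in> feasible" "\<not> primal_optimal (least_sq d) F C A b Xk"
  obtains X where "X \<in> feasible" "f Xk < f X"
proof -
  let ?g = "primal_objective (least_sq d) F C"
  obtain Z where Z: "Z \<in> feasible" "?g Xk < ?g Z"
    using assms by (auto simp: primal_optimal_def not_le)
  define D where "D = Z - Xk"
  define \<delta> where "\<delta> = ?g Z - ?g Xk"
  define q where "q = (norm D)\<^sup>2 / (2 * c)"
  \<comment> \<open>Chosen so that \<open>s * q < \<delta>\<close>: the proximal loss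
    \<open>s * (s * q)\<close> stays below the gain \<open>s * \<delta>\<close>.\<close>
  define s where "s = \<delta> / (\<delta> + q)"
  have q: "q \<ge> 0" "\<delta> > 0" using Z(2) c_pos by (simp_all add: q_def \<delta>_def)
  then have s: "0 < s" "s \<le> 1" "s * q < \<delta>"
    by (simp_all add: s_def field_simps add_pos_nonneg)
  have conv: "Xk + s *\<^sub>R D = (1 - s) *\<^sub>R Xk + s *\<^sub>R Z"
    by (simp add: D_def algebra_simps)
  have feas: "Xk + s *\<^sub>R D \<in> feasible"
    using assms(1) Z(1) s unfolding conv primal_feasible_def
    by (auto simp: psd_cone_add psd_cone_scaleR linear_add[OF linear_A] linear_scale[OF linear_A]
        simp flip: scaleR_add_left)
  have fg: "f X = ?g X - (norm (X - Xk))\<^sup>2 / (2 * c)" for X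
    by (simp add: prox_objective_def primal_objective_def)
  \<comment> \<open>The middle term is the surplus from concavity of the primal objective along the
    segment.\<close>
  have step: "f (Xk + s *\<^sub>R D) - f Xk
      = s * (grad Xk \<bullet> D - 1/2 * (norm (F D))\<^sup>2) + s * (1 - s) / 2 * (norm (F D))\<^sup>2 - s * (s * q)"
    unfolding f_expansion q_def
    using c_pos by (simp add: linear_scale[OF linear_F] power_mult_distrib field_simps power2_eq_square)
  have \<delta>: "grad Xk \<bullet> D - 1/2 * (norm (F D))\<^sup>2 = \<delta>"
    using f_expansion[of Xk D] fg[of Xk] fg[of Z] by (simp add: D_def \<delta>_def)
  have "0 \<le> s * (1 - s) / 2 * (norm (F D))\<^sup>2" using s by simp
  moreover have "s * (s * q) < s * \<delta>" using s by simp
  ultimately have "f Xk < f (Xk + s *\<^sub>R D)" using step unfolding \<delta> by linarith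
  with feas show thesis by (rule that)
qed

text \<open>Adding \<open>E\<close> restores the equation but may leave the cone. The mixture
  \<open>X + D = (1 - s) (X + E) + s Xhat\<close> keeps the equation, and the eigenvalue margin of
  \<open>Xhat\<close> absorbs \<open>E\<close>.\<close>

lemma feasible_correction:
  assumes surj_A: "surj A" and Xhat: "A Xhat = b" "pos_def Xhat" and X: "X \<in> psd_cone"
  defines "\<mu> \<equiv> inverse (sigma_min A) *
      max (inverse (lambda_min Xhat)) (1 + inverse (lambda_min Xhat) * norm Xhat)"
  obtains D where "X + D \<in> feasible" "norm D \<le> \<mu> * ((1 + norm X) * norm (A X - b))"
proof -
  define l where "l = lambda_min Xhat"
  define \<sigma> where "\<sigma> = sigma_min A"
  have l: "l > 0" unfolding l_def using Xhat(2) by (rule lambda_min_pos)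
  have \<sigma>: "\<sigma> > 0" unfolding \<sigma>_def using linear_A surj_A by (rule sigma_min_pos)
  obtain E where E: "A E = b - A X" "\<sigma> * norm E \<le> norm (b - A X)"
    using sigma_min_preimage[OF linear_A surj_A] unfolding \<sigma>_def by blast
  define n where "n = norm E"
  have n: "n \<ge> 0" by (simp add: n_def)
  have ln: "l + n > 0" using l n by simp
  \<comment> \<open>For nonzero \<open>E\<close>, this weight makes
    \<open>(1 - s) E + s Xhat\<close> equal to \<open>s\<close> times a perturbation of
    \<open>Xhat\<close> of norm exactly \<open>l\<close>.\<close>
  define s where "s = n / (l + n)"
  have s: "0 \<le> s" "s \<le> 1" "1 - s = l / (l + n)"
    using l n ln by (auto simp: s_def field_simps)
  define D where "D = (1 - s) *\<^sub>R E + s *\<^sub>R (Xhat - X)"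
  show thesis
  proof (rule that[of D])
    have "(1 - s) *\<^sub>R X + ((1 - s) *\<^sub>R E + s *\<^sub>R Xhat) \<in> psd_cone"
    proof (rule psd_cone_add)
      show "(1 - s) *\<^sub>R X \<in> psd_cone" using s by (simp add: psd_cone_scaleR X)
      show "(1 - s) *\<^sub>R E + s *\<^sub>R Xhat \<in> psd_cone"
      proof (cases "n = 0")
        case True
        then show ?thesis by (simp add: n_def s_def zero_in_psd_cone)
      next
        case False
        then have "n > 0" using n by simp
        then have "(1 - s) *\<^sub>R E + s *\<^sub>R Xhat = s *\<^sub>R (Xhat + (l / n) *\<^sub>R E)"
          unfolding s(3) by (simp add: s_def scaleR_add_right)
        moreover have "norm ((l / n) *\<^sub>R E) \<le> lambda_min Xhat"
          using \<open>n > 0\<close> l by (simp add: n_def[symmetric] l_def)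
        ultimately show ?thesis
          using s(1) by (simp add: psd_cone_scaleR pos_def_perturb[OF Xhat(2)])
      qed
    qed
    moreover have "(1 - s) *\<^sub>R X + ((1 - s) *\<^sub>R E + s *\<^sub>R Xhat) = X + D"
      by (simp add: D_def algebra_simps)
    moreover have "A (X + D) = b"
      by (simp add: D_def linear_add[OF linear_A] linear_scale[OF linear_A] linear_diff[OF linear_A]
          E(1) Xhat(1) algebra_simps)
    ultimately show "X + D \<in> feasible" by (simp add: primal_feasible_def)
    define M where "M = max (inverse l) (1 + inverse l * norm Xhat)"
    have "norm D \<le> norm ((1 - s) *\<^sub>R E) + norm (s *\<^sub>R (Xhat - X))"
      unfolding D_def by (rule norm_triangle_ineq)
    also have "\<dots> \<le> (1 - s) * n + s * (norm Xhat + norm X)"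
    proof -
      have "norm ((1 - s) *\<^sub>R E) = (1 - s) * n" using s(2) by (simp add: n_def)
      moreover have "norm (s *\<^sub>R (Xhat - X)) \<le> s * (norm Xhat + norm X)"
        using mult_left_mono[OF norm_triangle_ineq4 s(1), of Xhat X] s(1) by simp
      ultimately show ?thesis by linarith
    qed
    also have "\<dots> = n * ((l + norm Xhat + norm X) / (l + n))"
      using ln unfolding s(3) by (simp add: s_def add_divide_distrib algebra_simps)
    \<comment> \<open>Dropping \<open>n\<close> from the denominator leaves a bound linear in
      \<open>n\<close>.\<close>
    also have "\<dots> \<le> n * ((l + norm Xhat + norm X) / l)"
      using l n by (intro mult_left_mono divide_left_mono) auto
    also have "\<dots> = n * ((1 + inverse l * norm Xhat) + inverse l * norm X)"
      using l by (simp add: field_simps)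
    \<comment> \<open>\<open>M\<close> dominates both coefficients, so that
      \<open>1 + norm X\<close> factors out; hence the maximum in \<open>\<mu>\<close>.\<close>
    also have "\<dots> \<le> n * (M + M * norm X)"
      using n unfolding M_def by (intro mult_left_mono add_mono mult_right_mono) auto
    also have "\<dots> = (\<sigma> * n) * (inverse \<sigma> * (M * (1 + norm X)))"
      using \<sigma> by (simp add: field_simps)
    also have "\<dots> \<le> norm (b - A X) * (inverse \<sigma> * (M * (1 + norm X)))"
      using E(2) \<sigma> l by (intro mult_right_mono) (auto simp: n_def M_def le_max_iff_disj)
    finally show "norm D \<le> \<mu> * ((1 + norm X) * norm (A X - b))"
      by (simp add: \<mu>_def M_def \<sigma>_def l_def norm_minus_commute mult_ac)
  qed
qed

section \<open>From approximate feasibility to suboptimality\<close>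

lemma norm_F_le: "(norm (F D))\<^sup>2 \<le> max_eigenvalue (adjoint F \<circ> F) * (norm D)\<^sup>2"
  using rayleigh_le_max_eigenvalue[OF self_adjoint_gram[OF linear_F], of D]
    adjoint_eq[OF linear_F, of D "F D"]
  by (simp add: power2_norm_eq_inner)

lemma max_eigenvalue_gram_nonneg: "0 \<le> max_eigenvalue (adjoint F \<circ> F)"
proof -
  obtain D :: "'n symmat" where "norm D = 1" using vector_choose_size[of 1] by auto
  then have "(norm (F D))\<^sup>2 \<le> max_eigenvalue (adjoint F \<circ> F)" using norm_F_le[of D] by simp
  then show ?thesis by (rule order_trans[OF zero_le_power2])
qed

text \<open>\<open>L z - L_inf\<close> splits as \<open>(L z - f X) + (f X - f X') + (f X' - L_inf)\<close> with \<open>X'\<close> feasible near \<open>X\<close>.\<close>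

lemma suboptimality_bound:
  assumes surj_A: "surj A" and Xhat: "A Xhat = b" "pos_def Xhat" and X: "X \<in> psd_cone"
    and gap: "L z - f X \<le> t" and "t > 0"
    and infeas: "(1 + norm X) * norm (A X - b) \<le> feasibility_factor c (sqrt t) (grad X) * sqrt t"
    and \<mu>: "\<mu> = inverse (sigma_min A) *
      max (inverse (lambda_min Xhat)) (1 + inverse (lambda_min Xhat) * norm Xhat)"
  shows "L z - L_inf \<le> (1 + \<mu> + 1/2 * max_eigenvalue (adjoint F \<circ> F) * \<mu>\<^sup>2 + 1/2 * \<mu>\<^sup>2) * t"
proof -
  define e where "e = (1 + norm X) * norm (A X - b)"
  define M where "M = max_eigenvalue (adjoint F \<circ> F)"
  obtain D where D: "X + D \<in> feasible" "norm D \<le> \<mu> * e"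
    using feasible_correction[OF surj_A Xhat X] unfolding \<mu> e_def by metis
  have e0: "e \<ge> 0" by (simp add: e_def)
  have "0 < sigma_min A" "0 < lambda_min Xhat"
    using sigma_min_pos[OF linear_A surj_A] lambda_min_pos[OF Xhat(2)] .
  then have \<mu>0: "\<mu> > 0" unfolding \<mu> by (simp add: less_max_iff_disj)
  have M: "M \<ge> 0" unfolding M_def by (rule max_eigenvalue_gram_nonneg)
  let ?\<phi> = "feasibility_factor c (sqrt t) (grad X)"
  \<comment> \<open>Each entry controls one term of the expansion of \<open>f\<close> along
    \<open>D\<close>: \<open>1\<close> the one with \<open>F D\<close>, \<open>sqrt c\<close> the
    proximal one, the ratio the linear one.\<close>
  have fac: "?\<phi> \<le> 1" "?\<phi> \<le> sqrt c" "grad X \<noteq> 0 \<Longrightarrow> ?\<phi> \<le> sqrt t / norm (grad X)"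
    by (auto simp: feasibility_factor_def)
  have st: "sqrt t > 0" "sqrt t * sqrt t = t" using \<open>t > 0\<close> by auto
  have le: "e \<le> k * sqrt t" if "?\<phi> \<le> k" for k
    using mult_right_mono[OF that, of "sqrt t"] infeas st(1) unfolding e_def by linarith
  have e1: "e\<^sup>2 \<le> t"
  proof -
    have "e \<le> sqrt t" using le[OF fac(1)] by simp
    then show ?thesis using power_mono[OF _ e0, of "sqrt t" 2] \<open>t > 0\<close> by simp
  qed
  have e2: "e\<^sup>2 \<le> c * t"
  proof -
    have "e \<le> sqrt c * sqrt t" by (rule le[OF fac(2)])
    then show ?thesis
      using power_mono[OF _ e0, of "sqrt c * sqrt t" 2] \<open>t > 0\<close> c_pos by (simp add: power_mult_distrib)
  qed
  have e3: "norm (grad X) * e \<le> t"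
  \<comment> \<open>A zero gradient has no linear term to control, which matches reading the ratio
    as infinite.\<close>
  proof (cases "grad X = 0")
    case False
    then have "e \<le> sqrt t / norm (grad X) * sqrt t" by (intro le fac(3))
    then show ?thesis using False st by (simp add: field_simps)
  qed (use \<open>t > 0\<close> in simp)
  have D2: "(norm D)\<^sup>2 \<le> \<mu>\<^sup>2 * e\<^sup>2"
    using power_mono[OF D(2), of 2] by (simp add: power_mult_distrib)
  have "- (grad X \<bullet> D) \<le> norm (grad X) * norm D"
    using Cauchy_Schwarz_ineq2[of "grad X" D] by simp
  also have "\<dots> \<le> norm (grad X) * (\<mu> * e)" by (rule mult_left_mono[OF D(2)]) simp
  also have "\<dots> = \<mu> * (norm (grad X) * e)" by simp
  also have "\<dots> \<le> \<mu> * t" using e3 \<mu>0 by simp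
  finally have p1: "- (grad X \<bullet> D) \<le> \<mu> * t" .
  have D3: "(norm D)\<^sup>2 \<le> \<mu>\<^sup>2 * t"
    using D2 mult_left_mono[OF e1, of "\<mu>\<^sup>2"] by simp
  have "(norm (F D))\<^sup>2 \<le> M * (norm D)\<^sup>2" unfolding M_def by (rule norm_F_le)
  also have "\<dots> \<le> M * (\<mu>\<^sup>2 * t)" using D3 M by (rule mult_left_mono)
  finally have p2: "1/2 * (norm (F D))\<^sup>2 \<le> 1/2 * M * \<mu>\<^sup>2 * t" by simp
  have "(norm D)\<^sup>2 \<le> \<mu>\<^sup>2 * (c * t)"
    using D2 mult_left_mono[OF e2, of "\<mu>\<^sup>2"] by simp
  then have p3: "(norm D)\<^sup>2 / (2 * c) \<le> 1/2 * \<mu>\<^sup>2 * t"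
    using c_pos by (simp add: field_simps)
  have "f (X + D) \<le> L_inf" using D(1) by (rule le_L_inf)
  then have "L z - L_inf \<le> t + \<mu> * t + 1/2 * M * \<mu>\<^sup>2 * t + 1/2 * \<mu>\<^sup>2 * t"
    using gap p1 p2 p3 unfolding f_expansion by linarith
  then show ?thesis by (simp add: M_def algebra_simps)
qed

end

subsection \<open>Minimizing sequences\<close>

text \<open>Near \<open>a\<close>, the values of \<open>g\<close> stay within half the distance
  between \<open>g a\<close> and \<open>l\<close> from \<open>g a\<close>; the values
  \<open>g (X j)\<close> are eventually that close to \<open>l\<close> instead.\<close>

lemma eventually_away:
  fixes g :: "'a::metric_space \<Rightarrow> 'b::metric_space"
  assumes "isCont g a" and lim: "(\<lambda>j. g (X j)) \<longlonglongrightarrow> l" and "g a \<noteq> l"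
  obtains r where "r > 0" "eventually (\<lambda>j. r \<le> dist (X j) a) sequentially"
proof -
  define e where "e = dist (g a) l / 2"
  have "e > 0" using assms(3) by (simp add: e_def)
  then obtain r where r: "r > 0" "\<And>x. dist x a < r \<Longrightarrow> dist (g x) (g a) < e"
    using assms(1) unfolding continuous_at_eps_delta by blast
  have "eventually (\<lambda>j. dist (g (X j)) l < e) sequentially"
    using lim \<open>e > 0\<close> by (rule tendstoD)
  then have "eventually (\<lambda>j. r \<le> dist (X j) a) sequentially"
  proof eventually_elim
    case (elim j)
    show ?case
    proof (rule ccontr)
      assume "\<not> r \<le> dist (X j) a"
      then have "dist (g (X j)) (g a) < e" by (intro r(2)) simp
      then show False
        using elim dist_triangle2[of "g a" l "g (X j)"] by (simp add: e_def dist_commute)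
    qed
  qed
  with r(1) show thesis by (rule that)
qed

text \<open>A bound uniform in \<open>s\<close> and \<open>g\<close>: the ratio can only exceed
  \<open>s' / G\<close>, and a zero \<open>g\<close> drops an entry from the minimum.\<close>

lemma feasibility_factor_ge:
  assumes "0 \<le> s'" "s' \<le> s" "norm g \<le> G" "G > 0"
  shows "min 1 (min (sqrt c) (s' / G)) \<le> feasibility_factor c s g"
proof (cases "g = 0")
  case False
  then have "s' / G \<le> s / norm g" using assms by (intro frac_le) auto
  then show ?thesis using False by (auto simp: feasibility_factor_def)
qed (auto simp: feasibility_factor_def)

theorem proposition4p3:
  fixes A :: "'n::finite symmat \<Rightarrow> 'y::euclidean_space"
    and F :: "'n symmat \<Rightarrow> 'w::real_inner"
    and C Xhat Xk :: "'n symmat" and b :: 'y and d :: 'w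
    and c \<epsilon> \<eta> \<mu> \<nu> :: real
    and y :: "nat \<Rightarrow> 'y" and w :: "nat \<Rightarrow> 'w" and S X :: "nat \<Rightarrow> 'n symmat"
    and z :: "nat \<Rightarrow> 'y \<times> 'w \<times> 'n symmat" and u :: "nat \<Rightarrow> 'y" and t :: "nat \<Rightarrow> real"
    and h :: "'w \<Rightarrow> real" and \<zeta> :: "'y \<times> 'w \<times> 'n symmat \<Rightarrow> real"
    and inf_\<zeta> :: real and f :: "'n symmat \<Rightarrow> real"
  assumes W_finite_dim: "\<exists>B. finite B \<and> span B = (UNIV :: 'w set)"
    and linear_A: "linear A" and linear_F: "linear F"
    and c_pos: "c > 0"
    and h_eq: "h = least_sq d"
    and \<zeta>_eq: "\<zeta> = aug_lagrangian h F C A b c Xk"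
    and inf_\<zeta>_eq: "inf_\<zeta> = inf_aug_lagrangian h F C A b c Xk"
    and f_eq: "f = prox_objective h F C c Xk"
    and surj_A: "surj A"
    and Xhat: "A Xhat = b" "pos_def Xhat"
    and \<mu>_eq: "\<mu> = inverse (sigma_min A) *
          max (inverse (lambda_min Xhat)) (1 + inverse (lambda_min Xhat) * norm Xhat)"
    and \<nu>_pos: "\<nu> > 0" and \<epsilon>_pos: "\<epsilon> > 0" and \<eta>_pos: "\<eta> > 0"
    and Xk_psd: "Xk \<in> psd_cone" and Xk_not_optimal: "\<not> primal_optimal h F C A b Xk"
    and z_eq: "\<And>j. z j = (y j, w j, S j)"
    and S_eq: "\<And>j. S j = dual_slack F C A c Xk (y j) (w j)"
    and z_minimizing: "(\<lambda>j. \<zeta> (z j)) \<longlonglongrightarrow> inf_\<zeta>"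
    and X_eq: "\<And>j. X j = closest_point psd_cone
                            (Xk + c *\<^sub>R (adjoint A (y j) + adjoint F (w j) - C))"
    and u_eq: "\<And>j. u j = A (X j) - b"
    and t_eq: "\<And>j. t j = inverse \<nu> *
          min (\<epsilon>\<^sup>2 / (2 * c)) (\<eta>\<^sup>2 / (2 * c) * (norm (X j - Xk))\<^sup>2)"
  shows "\<exists>j0. \<forall>j\<ge>j0.
           \<zeta> (z j) - f (X j) \<le> t j \<and>
           (1 + norm (X j)) * norm (u j)
             \<le> feasibility_factor c (sqrt (t j)) (gradient f (X j)) * sqrt (t j) \<and>
           \<zeta> (z j) - inf_\<zeta>
             \<le> (1 + \<mu> + 1/2 * max_eigenvalue (adjoint F \<circ> F) * \<mu>\<^sup>2 + 1/2 * \<mu>\<^sup>2) * t j"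
proof -
  interpret P: least_squares_sdp A F C Xk b d c
    by (rule least_squares_sdp.intro) (fact linear_A linear_F c_pos)+
  have \<zeta>: "\<zeta> = P.L" and inf: "inf_\<zeta> = P.L_inf" and f: "f = P.f"
    by (simp_all add: \<zeta>_eq inf_\<zeta>_eq f_eq h_eq)
  have slack: "S j \<in> psd_cone" "X j \<in> psd_cone" "X j \<bullet> S j = 0"
    "Xk + c *\<^sub>R P.residual (y j) (w j) (S j) = X j" for j
    unfolding S_eq X_eq by (rule P.moreau_slack)+
  have Xhat_feasible: "Xhat \<in> P.feasible"
    using pos_def_perturb[OF Xhat(2), of 0] lambda_min_pos[OF Xhat(2)] Xhat(1)
    by (simp add: primal_feasible_def)
  have "P.feasible \<noteq> {}" using Xhat_feasible by blast
  then obtain K where K': "\<And>y w S. S \<in> psd_cone \<Longrightarrow>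
      (norm (A (Xk + c *\<^sub>R P.residual y w S) - b))\<^sup>2
        + (norm (w + F (Xk + c *\<^sub>R P.residual y w S) - d))\<^sup>2
      \<le> K * (P.L (y, w, S) - P.L_inf)"
    using P.gradient_norm_le_gap by blast
  \<comment> \<open>By \<open>slack(4)\<close> the unprojected point of the gradient bound is
    \<open>X j\<close> itself.\<close>
  have K: "(norm (u j))\<^sup>2 + (norm (w j + F (X j) - d))\<^sup>2 \<le> K * (\<zeta> (z j) - inf_\<zeta>)" for j
    using K'[OF slack(1), of "y j" "w j" j] unfolding slack(4) \<zeta> inf z_eq u_eq .
  have K0: "(\<lambda>j. K * (\<zeta> (z j) - inf_\<zeta>)) \<longlonglongrightarrow> 0"
    using tendsto_mult_right_zero[OF LIM_zero[OF z_minimizing]] .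
  have sq: "norm ((norm (u j))\<^sup>2) \<le> K * (\<zeta> (z j) - inf_\<zeta>)"
    "norm ((norm (w j + F (X j) - d))\<^sup>2) \<le> K * (\<zeta> (z j) - inf_\<zeta>)" for j
    using K[of j] zero_le_power2[of "norm (u j)"] zero_le_power2[of "norm (w j + F (X j) - d)"]
    unfolding real_norm_def abs_power2 by linarith+
  have u2: "(\<lambda>j. (norm (u j))\<^sup>2) \<longlonglongrightarrow> 0"
    and r0: "(\<lambda>j. (norm (w j + F (X j) - d))\<^sup>2) \<longlonglongrightarrow> 0"
    by (intro Lim_null_comparison[OF _ K0] always_eventually allI sq)+
  from tendsto_real_sqrt[OF u2] have u0: "(\<lambda>j. norm (u j)) \<longlonglongrightarrow> 0" by simp
  have "bounded (range (\<lambda>j. \<zeta> (z j)))"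
    using z_minimizing by (intro convergent_imp_bounded convergentI)
  then obtain B where "\<And>j. \<bar>\<zeta> (z j)\<bar> \<le> B" unfolding bounded_iff by auto
  then have B: "P.L (y j, w j, S j) \<le> B" for j
    by (metis \<zeta> z_eq abs_le_D1)
  obtain R where R: "\<And>j. norm (y j) \<le> R" "\<And>j. norm (X j) \<le> R"
    using P.level_set_bounded[OF surj_A Xhat, of B] B slack(1,4) by metis
  have yu0: "(\<lambda>j. u j \<bullet> y j) \<longlonglongrightarrow> 0"
  proof (rule Lim_null_comparison)
    have "norm (u j \<bullet> y j) \<le> norm (u j) * R" for j
      using Cauchy_Schwarz_ineq2[of "u j" "y j"] mult_left_mono[OF R(1), of "norm (u j)" j] by simp
    then show "\<forall>\<^sub>F j in sequentially. norm (u j \<bullet> y j) \<le> norm (u j) * R" by simp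
    show "(\<lambda>j. norm (u j) * R) \<longlonglongrightarrow> 0" using u0 by (rule tendsto_mult_left_zero)
  qed
  \<comment> \<open>Complementarity and \<open>slack(4)\<close> remove the last two terms of the gap
    identity.\<close>
  have "\<zeta> (z j) - f (X j) = u j \<bullet> y j + 1/2 * (norm (w j + F (X j) - d))\<^sup>2" for j
    using P.lagrangian_gap[of "y j" "w j" "S j" "X j"] slack(3,4)[of j]
    by (simp add: \<zeta> f z_eq u_eq)
  then have gap0: "(\<lambda>j. \<zeta> (z j) - f (X j)) \<longlonglongrightarrow> 0"
    using tendsto_add[OF yu0 tendsto_mult_right_zero[OF r0, of "1/2"]] by simp
  have fX: "(\<lambda>j. f (X j)) \<longlonglongrightarrow> inf_\<zeta>"
    using tendsto_diff[OF z_minimizing gap0] by simp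
  \<comment> \<open>A continuous function whose limit along \<open>X j\<close> differs from its
    value at \<open>Xk\<close> separates the two: \<open>A\<close> if \<open>Xk\<close> violates the
    equation, otherwise \<open>f\<close>, since some feasible \<open>Z\<close> has
    \<open>f Xk < f Z \<le> inf_\<zeta>\<close>.\<close>
  obtain r where r: "r > 0" "eventually (\<lambda>j. r \<le> dist (X j) Xk) sequentially"
  proof (cases "A Xk = b")
    case False
    have "(\<lambda>j. A (X j)) \<longlonglongrightarrow> b"
      using u0 unfolding u_eq tendsto_norm_zero_iff by (rule LIM_zero_cancel)
    then show thesis
      using eventually_away[where g = A and X = X and a = Xk and l = b]
        linear_continuous_at[OF P.bounded_linear_A] False that by blast
  next
    case True
    then have "Xk \<in> P.feasible" using Xk_psd by (simp add: primal_feasible_def)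
    then obtain Z where "Z \<in> P.feasible" "P.f Xk < P.f Z"
      using P.proximal_improvement Xk_not_optimal unfolding h_eq by blast
    then have "f Xk \<noteq> inf_\<zeta>" using P.le_L_inf unfolding f inf by fastforce
    moreover have "isCont f Xk"
      using P.continuous_on_f[of UNIV] unfolding f by (simp add: continuous_on_eq_continuous_at)
    ultimately show thesis using eventually_away[where g = f and X = X and a = Xk, OF _ fX] that by blast
  qed
  \<comment> \<open>The formula for \<open>t j\<close> with the distance to \<open>Xk\<close>
    replaced by its eventual lower bound \<open>r\<close>.\<close>
  define \<tau> where "\<tau> = inverse \<nu> * min (\<epsilon>\<^sup>2 / (2 * c)) (\<eta>\<^sup>2 / (2 * c) * r\<^sup>2)"
  have \<tau>: "\<tau> > 0" unfolding \<tau>_def using \<nu>_pos \<epsilon>_pos \<eta>_pos c_pos r(1) by simp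
  have t_ge: "\<tau> \<le> t j" if "r \<le> dist (X j) Xk" for j
  proof -
    have "r\<^sup>2 \<le> (norm (X j - Xk))\<^sup>2" using that r(1) by (simp add: dist_norm power_mono)
    then show ?thesis
      unfolding \<tau>_def t_eq using \<nu>_pos c_pos by (intro mult_left_mono min.mono) auto
  qed
  obtain G where G: "G > 0" "\<And>Y. norm Y \<le> R \<Longrightarrow> norm (P.grad Y) \<le> G"
    using P.grad_bounded by blast
  \<comment> \<open>A positive lower bound for the right-hand side of the second estimate whenever
    \<open>\<tau> \<le> t j\<close>.\<close>
  define \<kappa> where "\<kappa> = min 1 (min (sqrt c) (sqrt \<tau> / G)) * sqrt \<tau>"
  have \<kappa>: "\<kappa> > 0" unfolding \<kappa>_def using \<tau> G(1) c_pos by simp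
  have "(\<lambda>j. (1 + R) * norm (u j)) \<longlonglongrightarrow> 0" using u0 by (rule tendsto_mult_right_zero)
  then have "eventually (\<lambda>j. (1 + R) * norm (u j) < \<kappa>) sequentially"
    using \<kappa> by (rule order_tendstoD(2))
  moreover have "eventually (\<lambda>j. \<zeta> (z j) - f (X j) < \<tau>) sequentially"
    using gap0 \<tau> by (rule order_tendstoD(2))
  ultimately have "eventually (\<lambda>j. (1 + R) * norm (u j) < \<kappa> \<and> \<zeta> (z j) - f (X j) < \<tau>
      \<and> r \<le> dist (X j) Xk) sequentially"
    using r(2) by eventually_elim blast
  then obtain j0 where j0: "\<And>j. j \<ge> j0 \<Longrightarrow>
      (1 + R) * norm (u j) < \<kappa> \<and> \<zeta> (z j) - f (X j) < \<tau> \<and> r \<le> dist (X j) Xk"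
    unfolding eventually_sequentially by blast
  show ?thesis
  proof (intro exI[of _ j0] allI impI)
    fix j assume "j0 \<le> j"
    note j = j0[OF this]
    have t: "\<tau> \<le> t j" using j t_ge by blast
    have gap: "\<zeta> (z j) - f (X j) \<le> t j" using j t by linarith
    let ?\<phi> = "feasibility_factor c (sqrt (t j)) (gradient f (X j))"
    have "(1 + norm (X j)) * norm (u j) \<le> (1 + R) * norm (u j)"
      using R(2)[of j] by (intro mult_right_mono) auto
    also have "\<dots> \<le> \<kappa>" using j by simp
    also have "\<kappa> \<le> ?\<phi> * sqrt (t j)"
    proof -
      have \<phi>: "min 1 (min (sqrt c) (sqrt \<tau> / G)) \<le> ?\<phi>"
        using G R(2) t \<tau> unfolding f P.gradient_f by (intro feasibility_factor_ge) auto
      have "0 \<le> min 1 (min (sqrt c) (sqrt \<tau> / G))" using c_pos \<tau> G(1) by simp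
      then have "0 \<le> ?\<phi>" using \<phi> by (rule order_trans)
      then show ?thesis unfolding \<kappa>_def using \<phi> t \<tau> by (intro mult_mono) auto
    qed
    finally have infeas: "(1 + norm (X j)) * norm (u j) \<le> ?\<phi> * sqrt (t j)" .
    \<comment> \<open>The third estimate follows from the first two at the same \<open>j\<close>, so
      one \<open>j0\<close> serves all three.\<close>
    have "\<zeta> (z j) - inf_\<zeta>
        \<le> (1 + \<mu> + 1/2 * max_eigenvalue (adjoint F \<circ> F) * \<mu>\<^sup>2 + 1/2 * \<mu>\<^sup>2) * t j"
      using P.suboptimality_bound[OF surj_A Xhat slack(2)[of j] _ _ _ \<mu>_eq] gap infeas t \<tau>
      unfolding \<zeta> inf f P.gradient_f u_eq by simp
    with gap infeas show "\<zeta> (z j) - f (X j) \<le> t j \<and>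
        (1 + norm (X j)) * norm (u j) \<le> ?\<phi> * sqrt (t j) \<and>
        \<zeta> (z j) - inf_\<zeta>
          \<le> (1 + \<mu> + 1/2 * max_eigenvalue (adjoint F \<circ> F) * \<mu>\<^sup>2 + 1/2 * \<mu>\<^sup>2) * t j"
      by blast
  qed
qed

end
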